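(* Let $n\ge 3$, let $s\ge1$, let $\lambda=\sum_{i\in I}\lambda_i\Lambda_i$ be a dominant integral weight (all $\lambda_i\in\mathbb{Z}_{\ge0}$) of level $s$, i.e. $\sum_{i\in I}\lambda_i=s$, and let $\mu=\sum_{i\in I}\lambda_i\Lambda_{i-1}$ (indices mod $n$). Then the map $$\Phi:\mathcal{M}^{1,s}\otimes\mathcal{M}(\mu)\to\mathcal{M}(\lambda),\qquad m\otimes m'\mapsto m\cdot\tau_1(m'),$$ is a (well-defined) isomorphism of $U_q'(\widehat{\mathfrak{sl}}_n)$-crystals.
   Context: Crystals. $I=\mathbb{Z}/n\mathbb{Z}=\{0,1,\dots,n-1\}$ is the index set of $\widehat{\mathfrak{sl}}_n$ (type $A_{n-1}^{(1)}$), with simple coroots $h_i$, fundamental weights $\Lambda_i$ ($\langle h_i,\Lambda_j\rangle=\delta_{ij}$), and simple roots $\alpha_i=2\Lambda_i-\Lambda_{i-1}-\Lambda_{i+1}$ as $U_q'(\widehat{\mathfrak{sl}}_n)$-weights (that is, modulo the null root $\delta$). A $U_q'(\widehat{\mathfrak{sl}}_n)$-crystal is a set $B$ with maps $e_i,f_i:B\to B\sqcup\{0\}$, $\varepsilon_i,\varphi_i:B\to\mathbb{Z}$ and $\mathrm{wt}:B\to\bigoplus_i\mathbb{Z}\Lambda_i$ satisfying the usual crystal axioms. An isomorphism of crystals is a bijection that preserves $\mathrm{wt},\varepsilon_i,\varphi_i$ and commutes with all $e_i,f_i$ (with $0\mapsto 0$). Tensor product (opposite to Kashiwara's convention). $B_2\otimes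 B_1$ is the set $B_2\times B_1$ with $e_i(b_2\otimes b_1)=e_ib_2\otimes b_1$ if $\varepsilon_i(b_2)>\varphi_i(b_1)$ and $b_2\otimes e_ib_1$ otherwise; $f_i(b_2\otimes b_1)=f_ib_2\otimes b_1$ if $\varepsilon_i(b_2)\ge\varphi_i(b_1)$ and $b_2\otimes f_ib_1$ otherwise; $\varepsilon_i(b_2\otimes b_1)=\max(\varepsilon_i(b_1),\varepsilon_i(b_2)-\langle h_i,\mathrm{wt}(b_1)\rangle)$; $\varphi_i(b_2\otimes b_1)=\max(\varphi_i(b_2),\varphi_i(b_1)+\langle h_i,\mathrm{wt}(b_2)\rangle)$; $\mathrm{wt}(b_2\otimes b_1)=\mathrm{wt}(b_2)+\mathrm{wt}(b_1)$. Nakajima monomials. $\mathcal{M}$ is the set of Laurent monomials $m=\prod_{i\in I,k\in\mathbb{Z}}Y_{i,k}^{y_{i,k}}$ (finitely many nonzero exponents) in commuting variables $Y_{i,k}$. Put $\mathrm{wt}(m)=\sum_{i,k}y_{i,k}\Lambda_i$, $\ \varepsilon_i(m)=-\min_{k\in\mathbb{Z}}\sum_{t\ge k}y_{i,t}$, $\ \varphi_i(m)=\max_{k\in\mathbb{Z}}\sum_{t\le k}y_{i,t}$, $\ k_e(m)=\max\{k\mid \varepsilon_i(m)=-\sum_{t\ge k}y_{i,t}\}$ (used when $\varepsilon_i(m)>0$), $\ k_f(m)=\min\{k\mid\varphi_i(m)=\sum_{t\le k}y_{i,t}\}$ (used when $\varphi_i(m)>0$). With $A_{i,k}=Y_{i,k}Y_{i,k+1}Y_{i-1,k+1}^{-1}Y_{i+1,k}^{-1}$,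 set $e_i(m)=0$ if $\varepsilon_i(m)=0$ and $e_i(m)=m\,A_{i,k_e(m)-1}$ otherwise; $f_i(m)=0$ if $\varphi_i(m)=0$ and $f_i(m)=m\,A_{i,k_f(m)}^{-1}$ otherwise. For $j\in\mathbb{Z}$, $\tau_j$ is the shift $Y_{i,k}\mapsto Y_{i,k+j}$ extended multiplicatively. For $s\ge1$, $\mathcal{M}^{1,s}=\{\prod_{i=1}^nY_{i-1,1}^{-x_i}Y_{i,0}^{x_i}\mid x_i\in\mathbb{Z}_{\ge0},\ \sum_{i=1}^nx_i=s\}$ (first indices mod $n$). For a dominant integral weight $\nu=\sum_i\nu_i\Lambda_i$, $\mathcal{M}(\nu)$ is the closure of the monomial $Y_\nu=\prod_{i\in I}Y_{i,0}^{\nu_i}$ under all operators $e_i,f_i$, $i\in I$ (excluding $0$). All these sets of monomials carry the crystal structure just described. *)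

theory Defs
  imports "HOL-Library.Poly_Mapping"
begin

text \<open>
  The index set \<open>\<int>/n\<int>\<close> is represented by the residues \<open>{0..<n}\<close>; indices are reduced
  by \<open>mod n\<close> when weights and variables are formed.  Both the weight lattice and the
  (multiplicative) group of Laurent monomials are free abelian groups, so they are taken
  from the library type of finitely supported integer functions with generators
  \<^const>\<open>frag_of\<close>, integer multiples \<^const>\<open>frag_cmul\<close> and additive extension
  \<^const>\<open>frag_extend\<close>.
\<close>

definition idx :: "int \<Rightarrow> int set" where
  "idx n = {0..<n}"

type_synonym weight = "int \<Rightarrow>\<^sub>0 int"

definition fund_weight :: "int \<Rightarrow> int \<Rightarrow> weight" where
  "fund_weight n i = frag_of (i mod n)"

definition weight_lattice :: "int \<Rightarrow> weight set" where
  "weight_lattice n = {w. Poly_Mapping.keys w \<subseteq> idx n}"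

definition coroot_pairing :: "int \<Rightarrow> weight \<Rightarrow> int" where
  "coroot_pairing i w = Poly_Mapping.lookup w i"

text \<open>Simple roots modulo the null root.\<close>

definition simple_root :: "int \<Rightarrow> int \<Rightarrow> weight" where
  "simple_root n i =
     frag_cmul 2 (fund_weight n i) - fund_weight n (i - 1) - fund_weight n (i + 1)"

definition dominant :: "int \<Rightarrow> weight \<Rightarrow> bool" where
  "dominant n w \<longleftrightarrow> w \<in> weight_lattice n \<and> (\<forall>i\<in>idx n. coroot_pairing i w \<ge> 0)"

definition level :: "int \<Rightarrow> weight \<Rightarrow> int" where
  "level n w = (\<Sum>i\<in>idx n. coroot_pairing i w)"


text \<open>In a crystal, \<^const>\<open>None\<close> plays the role of the extra element \<open>0\<close>.\<close>

record 'b crystal =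
  elems :: "'b set"
  cry_e :: "int \<Rightarrow> 'b \<Rightarrow> 'b option"
  cry_f :: "int \<Rightarrow> 'b \<Rightarrow> 'b option"
  cry_eps :: "int \<Rightarrow> 'b \<Rightarrow> int"
  cry_phi :: "int \<Rightarrow> 'b \<Rightarrow> int"
  cry_wt :: "'b \<Rightarrow> weight"

definition is_crystal :: "int \<Rightarrow> 'b crystal \<Rightarrow> bool" where
  "is_crystal n B \<longleftrightarrow>
     (\<forall>b\<in>elems B. cry_wt B b \<in> weight_lattice n) \<and>
     (\<forall>i\<in>idx n. \<forall>b\<in>elems B.
        cry_phi B i b = cry_eps B i b + coroot_pairing i (cry_wt B b) \<and>
        (\<forall>b'. cry_e B i b = Some b' \<longrightarrow>
           b' \<in> elems B \<and>
           cry_wt B b' = cry_wt B b + simple_root n i \<and>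
           cry_eps B i b' = cry_eps B i b - 1 \<and>
           cry_phi B i b' = cry_phi B i b + 1) \<and>
        (\<forall>b'. cry_f B i b = Some b' \<longrightarrow>
           b' \<in> elems B \<and>
           cry_wt B b' = cry_wt B b - simple_root n i \<and>
           cry_eps B i b' = cry_eps B i b + 1 \<and>
           cry_phi B i b' = cry_phi B i b - 1) \<and>
        (\<forall>b'\<in>elems B. cry_f B i b = Some b' \<longleftrightarrow> cry_e B i b' = Some b))"

definition crystal_iso :: "int \<Rightarrow> 'a crystal \<Rightarrow> 'b crystal \<Rightarrow> ('a \<Rightarrow> 'b) \<Rightarrow> bool" where
  "crystal_iso n B C \<psi> \<longleftrightarrow>
     is_crystal n B \<and> is_crystal n C \<and>
     bij_betw \<psi> (elems B) (elems C) \<and>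
     (\<forall>b\<in>elems B. cry_wt C (\<psi> b) = cry_wt B b) \<and>
     (\<forall>i\<in>idx n. \<forall>b\<in>elems B.
        cry_eps C i (\<psi> b) = cry_eps B i b \<and>
        cry_phi C i (\<psi> b) = cry_phi B i b \<and>
        cry_e C i (\<psi> b) = map_option \<psi> (cry_e B i b) \<and>
        cry_f C i (\<psi> b) = map_option \<psi> (cry_f B i b))"

text \<open>The tensor product convention is opposite to Kashiwara's; the pair \<open>(b2, b1)\<close> stands
  for \<open>b2 \<otimes> b1\<close>, which is \<open>0\<close> as soon as one of the factors is.\<close>

definition tensor :: "'a crystal \<Rightarrow> 'b crystal \<Rightarrow> ('a \<times> 'b) crystal" where
  "tensor B2 B1 = \<lparr>
     elems = elems B2 \<times> elems B1,
     cry_e = (\<lambda>i (b2, b1).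
        if cry_eps B2 i b2 > cry_phi B1 i b1
        then map_option (\<lambda>c. (c, b1)) (cry_e B2 i b2)
        else map_option (\<lambda>c. (b2, c)) (cry_e B1 i b1)),
     cry_f = (\<lambda>i (b2, b1).
        if cry_eps B2 i b2 \<ge> cry_phi B1 i b1
        then map_option (\<lambda>c. (c, b1)) (cry_f B2 i b2)
        else map_option (\<lambda>c. (b2, c)) (cry_f B1 i b1)),
     cry_eps = (\<lambda>i (b2, b1).
        max (cry_eps B1 i b1) (cry_eps B2 i b2 - coroot_pairing i (cry_wt B1 b1))),
     cry_phi = (\<lambda>i (b2, b1).
        max (cry_phi B2 i b2) (cry_phi B1 i b1 + coroot_pairing i (cry_wt B2 b2))),
     cry_wt = (\<lambda>(b2, b1). cry_wt B2 b2 + cry_wt B1 b1) \<rparr>"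


text \<open>A monomial is its family of exponents, \<open>Poly_Mapping.lookup m (i, k)\<close> being the exponent
  of \<open>Y\<^bsub>i,k\<^esub>\<close>.  Hence multiplication of monomials is written \<open>+\<close>, inversion is written \<open>-\<close>, and
  the \<open>c\<close>-th power is \<open>frag_cmul c\<close>.\<close>

type_synonym monomial = "(int \<times> int) \<Rightarrow>\<^sub>0 int"

definition Yvar :: "int \<Rightarrow> int \<Rightarrow> int \<Rightarrow> monomial" where
  "Yvar n i k = frag_of (i mod n, k)"

definition Avar :: "int \<Rightarrow> int \<Rightarrow> int \<Rightarrow> monomial" where
  "Avar n i k = Yvar n i k + Yvar n i (k + 1) - Yvar n (i - 1) (k + 1) - Yvar n (i + 1) k"

definition mon_wt :: "int \<Rightarrow> monomial \<Rightarrow> weight" where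
  "mon_wt n = frag_extend (\<lambda>(i, k). fund_weight n i)"

text \<open>The sums of all exponents \<open>y\<^bsub>i,t\<^esub>\<close> with \<open>t \<ge> k\<close>, respectively \<open>t \<le> k\<close>, restricted to the
  finite support.\<close>

definition upper_sum :: "monomial \<Rightarrow> int \<Rightarrow> int \<Rightarrow> int" where
  "upper_sum m i k =
     (\<Sum>t | t \<ge> k \<and> (i, t) \<in> Poly_Mapping.keys m. Poly_Mapping.lookup m (i, t))"

definition lower_sum :: "monomial \<Rightarrow> int \<Rightarrow> int \<Rightarrow> int" where
  "lower_sum m i k =
     (\<Sum>t | t \<le> k \<and> (i, t) \<in> Poly_Mapping.keys m. Poly_Mapping.lookup m (i, t))"

text \<open>The ranges below are finite, since the partial sums take finitely many values.\<close>

definition mon_eps :: "int \<Rightarrow> monomial \<Rightarrow> int" where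
  "mon_eps i m = - Min (range (upper_sum m i))"

definition mon_phi :: "int \<Rightarrow> monomial \<Rightarrow> int" where
  "mon_phi i m = Max (range (lower_sum m i))"

definition mon_ke :: "int \<Rightarrow> monomial \<Rightarrow> int" where
  "mon_ke i m = (GREATEST k. mon_eps i m = - upper_sum m i k)"

definition mon_kf :: "int \<Rightarrow> monomial \<Rightarrow> int" where
  "mon_kf i m = (LEAST k. mon_phi i m = lower_sum m i k)"

definition mon_e :: "int \<Rightarrow> int \<Rightarrow> monomial \<Rightarrow> monomial option" where
  "mon_e n i m = (if mon_eps i m = 0 then None else Some (m + Avar n i (mon_ke i m - 1)))"

definition mon_f :: "int \<Rightarrow> int \<Rightarrow> monomial \<Rightarrow> monomial option" where
  "mon_f n i m = (if mon_phi i m = 0 then None else Some (m - Avar n i (mon_kf i m)))"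

definition monomial_crystal :: "int \<Rightarrow> monomial set \<Rightarrow> monomial crystal" where
  "monomial_crystal n S = \<lparr> elems = S, cry_e = mon_e n, cry_f = mon_f n,
     cry_eps = mon_eps, cry_phi = mon_phi, cry_wt = mon_wt n \<rparr>"

definition tau :: "int \<Rightarrow> monomial \<Rightarrow> monomial" where
  "tau j = frag_extend (\<lambda>(i, k). frag_of (i, k + j))"

definition M1s :: "int \<Rightarrow> nat \<Rightarrow> monomial set" where
  "M1s n s =
     {(\<Sum>i\<in>{1..n}. frag_cmul (- int (x i)) (Yvar n (i - 1) 1)
                    + frag_cmul (int (x i)) (Yvar n i 0))
      | x :: int \<Rightarrow> nat. (\<Sum>i\<in>{1..n}. x i) = s}"

definition Y_weight :: "int \<Rightarrow> weight \<Rightarrow> monomial" where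
  "Y_weight n \<nu> = (\<Sum>i\<in>idx n. frag_cmul (coroot_pairing i \<nu>) (Yvar n i 0))"

inductive_set M_of :: "int \<Rightarrow> weight \<Rightarrow> monomial set" for n \<nu> where
  base: "Y_weight n \<nu> \<in> M_of n \<nu>"
| step_e: "m \<in> M_of n \<nu> \<Longrightarrow> i \<in> idx n \<Longrightarrow> mon_e n i m = Some m' \<Longrightarrow> m' \<in> M_of n \<nu>"
| step_f: "m \<in> M_of n \<nu> \<Longrightarrow> i \<in> idx n \<Longrightarrow> mon_f n i m = Some m' \<Longrightarrow> m' \<in> M_of n \<nu>"

end

theory Submission
  imports Defs
begin

text \<open>
  Everything about \<open>i\<close> is read off the partial sums \<open>L\<^sub>i(k) = \<Sum>\<^bsub>t\<le>k\<^esub> y\<^bsub>i,t\<^esub>\<close>: \<open>\<phi>\<^sub>i\<close> is their maximum,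
  \<open>f\<^sub>i\<close> acts at the first and \<open>e\<^sub>i\<close> at the last place where it is attained.  If \<open>m'\<close> only involves
  variables \<open>Y\<^bsub>i,k\<^esub>\<close> with \<open>k \<ge> 0\<close>, the partial sums of \<open>m \<cdot> \<tau>\<^sub>1(m')\<close> with \<open>m \<in> \<M>\<^bsup>1,s\<^esup>\<close> are
  \<open>x\<^sub>i\<close> followed by those of \<open>m'\<close> shifted by \<open>x\<^sub>i - x\<^bsub>i+1\<^esub>\<close>, and this is the tensor product rule.

  The essential point is that \<open>\<M>(\<lambda>)\<close> is exactly the set of products \<open>\<Prod>\<^sub>k \<tau>\<^sub>k(m\<^sub>k)\<close> of elements
  \<open>m\<^sub>k\<close> of \<open>\<M>\<^bsup>1,s\<^esup>\<close> which eventually agree with the ground state \<open>x\<^sub>i = \<lambda>\<^bsub>i+k\<^esub>\<close>.  These products are the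
  monomials \<open>Y\<^sub>\<lambda> \<Prod> A\<^bsub>i,k\<^esub>\<^bsup>-c(k,i)\<^esup>\<close> for which all the multiplicities
  \<open>\<lambda>\<^bsub>i+k\<^esub> - c(k,i) + c(k,i-1)\<close> are nonnegative; they are closed under all \<open>e\<^sub>i\<close> and \<open>f\<^sub>i\<close>.  One may choose
  \<open>c \<ge> 0\<close> with \<open>c(k+1,i) \<le> c(k,i+1)\<close>; then every \<open>e\<^sub>i\<close> lowers \<open>\<Sum> c\<close> by one and preserves these
  inequalities, so repeated application of the \<open>e\<^sub>i\<close> terminates, and it can only do so at \<open>Y\<^sub>\<lambda>\<close>.
\<close>

section \<open>Partial sums of exponents\<close>

text \<open>A recursion in \<open>k\<close> and vanishing far to the left determine the partial
  sums. Explicit partial sums below are obtained this way, without handling supports.\<close>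

lemma lower_sum_unique:
  assumes step: "\<And>k. F k = F (k - 1) + Poly_Mapping.lookup m (i, k)"
    and zero: "\<And>k. k < a \<Longrightarrow> F k = 0"
  shows "lower_sum m i k = F k"
proof -
  let ?y = "\<lambda>t. Poly_Mapping.lookup m (i, t)"
  have y0: "?y t = 0" if "t < a" for t
    using step[of t] zero[of t] zero[of "t - 1"] that by simp
  have "lower_sum m i k = (\<Sum>t\<in>{a..k}. ?y t)"
    unfolding lower_sum_def
    by (rule sum.mono_neutral_left) (use y0 in \<open>auto simp: in_keys_iff intro!: leI\<close>)
  also have "\<dots> = F k"
  proof (cases "k < a")
    case False
    then have "a - 1 \<le> k" by simp
    then show ?thesis
    proof (induction k rule: int_ge_induct)
      case base
      then show ?case using zero[of "a - 1"] by simp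
    next
      case (step j)
      then have "{a..j + 1} = insert (j + 1) {a..j}" by auto
      then show ?case using step assms(1)[of "j + 1"] by simp
    qed
  qed (use zero in simp)
  finally show ?thesis .
qed

text \<open>For reduced first indices this is the pairing of the weight with the coroot
  \<open>i\<close>, see \<open>row_total_eq\<close>; as a sum of exponents it does not mention
  \<open>n\<close>.\<close>

definition row_total :: "monomial \<Rightarrow> int \<Rightarrow> int" where
  "row_total m i = (\<Sum>t | (i, t) \<in> Poly_Mapping.keys m. Poly_Mapping.lookup m (i, t))"

lemma finite_row: "finite {t. (i, t) \<in> Poly_Mapping.keys (m :: monomial)}"
  using finite_vimageI[of "Poly_Mapping.keys m" "Pair i"] by (simp add: vimage_def inj_on_def)

lemma row_bounds:
  obtains a b where "\<And>t. Poly_Mapping.lookup (m :: monomial) (i, t) \<noteq> 0 \<Longrightarrow> a \<le> t \<and> t \<le> b"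
proof -
  let ?R = "{t. (i, t) \<in> Poly_Mapping.keys m}"
  have "\<exists>a b. \<forall>t\<in>?R. a \<le> t \<and> t \<le> b"
    using finite_row[of i m] by (meson Max_ge Min_le)
  then show thesis using that by (auto simp: in_keys_iff)
qed

lemma lower_sum_step:
  "lower_sum m i k = lower_sum m i (k - 1) + Poly_Mapping.lookup m (i, k)"
proof (cases "(i, k) \<in> Poly_Mapping.keys m")
  case True
  then have "{t. t \<le> k \<and> (i, t) \<in> Poly_Mapping.keys m} =
      insert k {t. t \<le> k - 1 \<and> (i, t) \<in> Poly_Mapping.keys m}" by auto
  then show ?thesis
    using finite_row[of i m] by (simp add: lower_sum_def)
next
  case False
  then have "{t. t \<le> k \<and> (i, t) \<in> Poly_Mapping.keys m} =
      {t. t \<le> k - 1 \<and> (i, t) \<in> Poly_Mapping.keys m}"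
    by (auto simp: order_le_less)
  then show ?thesis using False by (simp add: lower_sum_def in_keys_iff)
qed

text \<open>Finite support makes the partial sums constant at both ends, which gives their range
  finitely many values and lets a first and a last maximum exist.\<close>

lemma lower_sum_bounds:
  obtains a b where "\<And>k. k < a \<Longrightarrow> lower_sum m i k = 0" "\<And>k. b \<le> k \<Longrightarrow> lower_sum m i k = row_total m i"
proof -
  obtain a b where ab: "\<And>t. Poly_Mapping.lookup m (i, t) \<noteq> 0 \<Longrightarrow> a \<le> t \<and> t \<le> b"
    using row_bounds[of m i] by metis
  have 1: "{t. t \<le> k \<and> (i, t) \<in> Poly_Mapping.keys m} = {}" if "k < a" for k
    using ab that by (force simp: in_keys_iff)
  have 2: "{t. t \<le> k \<and> (i, t) \<in> Poly_Mapping.keys m} = {t. (i, t) \<in> Poly_Mapping.keys m}"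
    if "b \<le> k" for k
    using ab that by (force simp: in_keys_iff)
  show thesis
    by (rule that[of a b]) (simp_all only: lower_sum_def row_total_def 1 2 sum.empty)
qed

text \<open>Tails are complements of initial segments, so \<open>mon_eps\<close> and
  \<open>mon_ke\<close> can also be read off \<open>lower_sum\<close>.\<close>

lemma upper_sum_eq: "upper_sum m i k = row_total m i - lower_sum m i (k - 1)"
proof -
  let ?R = "{t. (i, t) \<in> Poly_Mapping.keys m}"
  have "?R = {t. t \<ge> k \<and> t \<in> ?R} \<union> {t. t \<le> k - 1 \<and> t \<in> ?R}" by auto
  then have "row_total m i = (\<Sum>t\<in>{t. t \<ge> k \<and> t \<in> ?R} \<union> {t. t \<le> k - 1 \<and> t \<in> ?R}. Poly_Mapping.lookup m (i, t))"
    unfolding row_total_def by presburger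
  also have "\<dots> = upper_sum m i k + lower_sum m i (k - 1)"
    unfolding upper_sum_def lower_sum_def
    by (subst sum.union_disjoint) (use finite_row[of i m] in auto)
  finally show ?thesis by simp
qed

text \<open>The range of partial sums is finite, so the maximum is attained; comparing it with the
  two constant ends gives the bounds by 0 and by the row total. Minimising tails is maximising
  initial sums, hence \<open>eps_eq\<close>.\<close>

lemma
  shows lower_sum_le_phi: "lower_sum m i k \<le> mon_phi i m"
    and phi_attained: "\<exists>k. lower_sum m i k = mon_phi i m"
    and eps_eq: "mon_eps i m = mon_phi i m - row_total m i"
    and phi_ge_0: "0 \<le> mon_phi i m"
    and total_le_phi: "row_total m i \<le> mon_phi i m"
proof -
  obtain a b where a: "\<And>k. k < a \<Longrightarrow> lower_sum m i k = 0"
    and b: "\<And>k. b \<le> k \<Longrightarrow> lower_sum m i k = row_total m i"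
    using lower_sum_bounds[of m i] by metis
  have "range (lower_sum m i) \<subseteq> insert 0 (insert (row_total m i) (lower_sum m i ` {a..b}))"
  proof (rule image_subsetI)
    fix k
    consider "k < a" | "b \<le> k" | "k \<in> {a..b}" by force
    then show "lower_sum m i k \<in> insert 0 (insert (row_total m i) (lower_sum m i ` {a..b}))"
      by cases (use a b in \<open>simp_all only: insert_iff image_eqI simp_thms\<close>)
  qed
  then have fin: "finite (range (lower_sum m i))"
    by (rule finite_subset) simp
  show le: "lower_sum m i k \<le> mon_phi i m" for k
    unfolding mon_phi_def by (rule Max_ge) (use fin in auto)
  show att: "\<exists>k. lower_sum m i k = mon_phi i m"
    unfolding mon_phi_def using Max_in[OF fin] by fastforce
  show "0 \<le> mon_phi i m" using le[of "a - 1"] a[of "a - 1"] by simp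
  show "row_total m i \<le> mon_phi i m" using le[of b] b[of b] by simp
  obtain k where k: "lower_sum m i k = mon_phi i m" using att by blast
  have "Min (range (upper_sum m i)) = row_total m i - mon_phi i m"
  proof (rule Min_eqI)
    have "range (upper_sum m i) \<subseteq> (\<lambda>v. row_total m i - v) ` range (lower_sum m i)"
      by (auto simp: upper_sum_eq)
    then show "finite (range (upper_sum m i))" by (rule finite_subset) (use fin in simp)
    show "\<And>y. y \<in> range (upper_sum m i) \<Longrightarrow> row_total m i - mon_phi i m \<le> y"
      using le by (auto simp: upper_sum_eq)
    show "row_total m i - mon_phi i m \<in> range (upper_sum m i)"
      by (rule image_eqI[of _ _ "k + 1"]) (simp_all add: upper_sum_eq k)
  qed
  then show "mon_eps i m = mon_phi i m - row_total m i" by (simp add: mon_eps_def)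
qed

lemma phi_eqI:
  assumes "\<And>k. lower_sum m i k \<le> p" "lower_sum m i K = p"
  shows "mon_phi i m = p"
  using assms phi_attained[of m i] lower_sum_le_phi[of m i K] by (metis order_antisym)

lemma kf_eqI:
  assumes "lower_sum m i K = mon_phi i m" "\<And>k. k < K \<Longrightarrow> lower_sum m i k < mon_phi i m"
  shows "mon_kf i m = K"
  unfolding mon_kf_def
  by (rule Least_equality) (use assms in \<open>auto intro!: leI\<close>)

text \<open>The tail from \<open>k\<close> complements the initial sum up to \<open>k - 1\<close>,
  so the greatest minimising tail starts one place after the last maximum \<open>K\<close>.\<close>

lemma ke_eqI:
  assumes "lower_sum m i K = mon_phi i m" "\<And>k. k > K \<Longrightarrow> lower_sum m i k < mon_phi i m"
  shows "mon_ke i m = K + 1"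
  unfolding mon_ke_def
proof (rule Greatest_equality)
  show "mon_eps i m = - upper_sum m i (K + 1)"
    using assms(1) by (simp add: upper_sum_eq eps_eq)
  show "k \<le> K + 1" if "mon_eps i m = - upper_sum m i k" for k
    using that assms(2)[of "k - 1"] by (force simp: upper_sum_eq eps_eq)
qed

text \<open>A least integer need not exist. A nonzero maximum cannot occur where the sums are still
  0, so only places \<open>a + int j\<close> with \<open>j\<close> natural compete.\<close>

lemma kf_props:
  assumes "mon_phi i m \<noteq> 0"
  shows "lower_sum m i (mon_kf i m) = mon_phi i m"
    and "\<And>k. k < mon_kf i m \<Longrightarrow> lower_sum m i k < mon_phi i m"
proof -
  obtain a b where a: "\<And>k. k < a \<Longrightarrow> lower_sum m i k = 0"
    using lower_sum_bounds by metis
  define Q where "Q j \<longleftrightarrow> lower_sum m i (a + int j) = mon_phi i m" for j :: nat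
  obtain k where k: "lower_sum m i k = mon_phi i m" using phi_attained by blast
  with a assms have "a \<le> k" by (metis not_less)
  then have "Q (nat (k - a))" using k by (simp add: Q_def)
  then have Q: "Q (Least Q)" and least: "\<And>j. j < Least Q \<Longrightarrow> \<not> Q j"
    by (auto intro: LeastI dest: not_less_Least)
  have lt: "lower_sum m i j < mon_phi i m" if "j < a + int (Least Q)" for j
  proof (cases "j < a")
    case True
    then show ?thesis using a phi_ge_0[of i m] assms by simp
  next
    case False
    then have "\<not> Q (nat (j - a))" using that by (intro least) simp
    then show ?thesis using False lower_sum_le_phi[of m i j] by (simp add: Q_def)
  qed
  have "mon_kf i m = a + int (Least Q)"
    by (rule kf_eqI) (use Q lt in \<open>auto simp: Q_def\<close>)
  then show "lower_sum m i (mon_kf i m) = mon_phi i m"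
    "\<And>k. k < mon_kf i m \<Longrightarrow> lower_sum m i k < mon_phi i m"
    using Q lt by (auto simp: Q_def)
qed

text \<open>Mirror image: \<open>mon_eps\<close> being nonzero puts the row total below the maximum,
  so all maxima lie at or before \<open>b\<close>, and the search runs downwards.\<close>

lemma ke_props:
  assumes "mon_eps i m \<noteq> 0"
  shows "lower_sum m i (mon_ke i m - 1) = mon_phi i m"
    and "\<And>k. k > mon_ke i m - 1 \<Longrightarrow> lower_sum m i k < mon_phi i m"
proof -
  obtain a b where b: "\<And>k. b \<le> k \<Longrightarrow> lower_sum m i k = row_total m i"
    using lower_sum_bounds by metis
  define Q where "Q j \<longleftrightarrow> lower_sum m i (b - int j) = mon_phi i m" for j :: nat
  obtain k where k: "lower_sum m i k = mon_phi i m" using phi_attained by blast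
  with b assms have "k \<le> b" by (metis eps_eq diff_self linorder_le_cases)
  then have "Q (nat (b - k))" using k by (simp add: Q_def)
  then have Q: "Q (Least Q)" and least: "\<And>j. j < Least Q \<Longrightarrow> \<not> Q j"
    by (auto intro: LeastI dest: not_less_Least)
  have lt: "lower_sum m i j < mon_phi i m" if "j > b - int (Least Q)" for j
  proof (cases "j > b")
    case True
    then show ?thesis using b total_le_phi[of m i] assms by (simp add: eps_eq)
  next
    case False
    then have "\<not> Q (nat (b - j))" using that by (intro least) simp
    then show ?thesis using False lower_sum_le_phi[of m i j] by (simp add: Q_def)
  qed
  have "mon_ke i m = b - int (Least Q) + 1"
    by (rule ke_eqI) (use Q lt in \<open>auto simp: Q_def\<close>)
  then show "lower_sum m i (mon_ke i m - 1) = mon_phi i m"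
    "\<And>k. k > mon_ke i m - 1 \<Longrightarrow> lower_sum m i k < mon_phi i m"
    using Q lt by (auto simp: Q_def)
qed

section \<open>Crystals of monomials\<close>

text \<open>The type \<open>monomial\<close> admits every integer as a first index; this set keeps
  the elements whose first indices are reduced residues.\<close>

definition monomials :: "int \<Rightarrow> monomial set" where
  "monomials n = {m. Poly_Mapping.keys m \<subseteq> idx n \<times> UNIV}"

lemma lookup_eq_0_monomials:
  assumes "m \<in> monomials n" "i \<notin> idx n"
  shows "Poly_Mapping.lookup m (i, k) = 0"
  using assms by (auto simp: monomials_def in_keys_iff)

lemma monomials_eqI:
  assumes "m \<in> monomials n" "m' \<in> monomials n"
    and "\<And>i k. i \<in> idx n \<Longrightarrow> Poly_Mapping.lookup m (i, k) = Poly_Mapping.lookup m' (i, k)"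
  shows "m = m'"
proof (rule poly_mapping_eqI)
  fix p :: "int \<times> int"
  obtain i k where p: "p = (i, k)" by force
  show "Poly_Mapping.lookup m p = Poly_Mapping.lookup m' p"
    using assms p by (cases "i \<in> idx n") (simp_all add: lookup_eq_0_monomials)
qed

lemma monomials_closed [simp, intro]:
  shows monomials_0: "0 \<in> monomials n"
    and monomials_add: "m \<in> monomials n \<Longrightarrow> m' \<in> monomials n \<Longrightarrow> m + m' \<in> monomials n"
    and monomials_diff: "m \<in> monomials n \<Longrightarrow> m' \<in> monomials n \<Longrightarrow> m - m' \<in> monomials n"
    and monomials_cmul: "m \<in> monomials n \<Longrightarrow> frag_cmul c m \<in> monomials n"
  unfolding monomials_def mem_Collect_eq
  by (simp, meson keys_add order_trans Un_least, meson keys_diff order_trans Un_least,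
      meson keys_cmul order_trans)

lemma monomials_sum [intro]: "(\<And>x. x \<in> S \<Longrightarrow> g x \<in> monomials n) \<Longrightarrow> sum g S \<in> monomials n"
  by (induction S rule: infinite_finite_induct) auto

lemma mod_in_idx [simp]: "0 < n \<Longrightarrow> i mod n \<in> idx n"
  by (simp add: idx_def)

lemma idx_mod [simp]: "i \<in> idx n \<Longrightarrow> i mod n = i"
  by (simp add: idx_def)

lemma monomials_Yvar [intro]: "0 < n \<Longrightarrow> Yvar n i k \<in> monomials n"
  by (simp add: monomials_def Yvar_def)

lemma monomials_Avar [intro]: "0 < n \<Longrightarrow> Avar n i k \<in> monomials n"
  unfolding Avar_def by (intro monomials_add monomials_diff monomials_Yvar)

lemma lookup_Yvar:
  "Poly_Mapping.lookup (Yvar n i k) (j, l) = (if i mod n = j \<and> k = l then 1 else 0)"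
  by (simp add: Yvar_def lookup_single when_def)

lemma shift_mod_neq:
  assumes "3 \<le> n"
  shows "(i + 1) mod n \<noteq> i mod (n :: int)" "(i - 1) mod n \<noteq> i mod n"
  using assms zdvd_not_zless[of 1 n] by (auto simp: mod_eq_dvd_iff)

text \<open>Both neighbours of \<open>i\<close> differ from \<open>i\<close> modulo
  \<open>n\<close>, so the inverse factors of \<open>Avar\<close> miss row \<open>i\<close>.\<close>

lemma lookup_Avar_self:
  assumes "3 \<le> n" "i \<in> idx n"
  shows "Poly_Mapping.lookup (Avar n i K) (i, k) = (if k = K \<or> k = K + 1 then 1 else 0)"
  using assms shift_mod_neq[of n i]
  by (simp add: Avar_def lookup_add lookup_minus lookup_Yvar)

lemma coroot_pairing_simple_root:
  assumes "3 \<le> n" "i \<in> idx n"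
  shows "coroot_pairing i (simple_root n i) = 2"
  using assms shift_mod_neq[of n i]
  by (simp add: coroot_pairing_def simple_root_def fund_weight_def lookup_minus lookup_single
      when_def)

lemma mon_wt_Avar: "mon_wt n (Avar n i k) = simple_root n i"
proof -
  have "frag_of a + frag_of a = frag_cmul 2 (frag_of a)" for a :: int
    using frag_cmul_distrib[of 1 1 "frag_of a"] by simp
  then show ?thesis
    by (simp add: mon_wt_def Avar_def Yvar_def simple_root_def fund_weight_def
      frag_extend_add frag_extend_diff)
qed

lemma coroot_pairing_add:
  "coroot_pairing i (v + w) = coroot_pairing i v + coroot_pairing i w"
  "coroot_pairing i (v - w) = coroot_pairing i v - coroot_pairing i w"
  by (simp_all add: coroot_pairing_def lookup_add lookup_minus)

lemma mon_wt_in_lattice: "0 < n \<Longrightarrow> mon_wt n m \<in> weight_lattice n"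
  unfolding mon_wt_def weight_lattice_def mem_Collect_eq
  by (rule order_trans[OF keys_frag_extend]) (auto simp: fund_weight_def)

lemma row_total_eq:
  assumes "m \<in> monomials n" "i \<in> idx n"
  shows "row_total m i = coroot_pairing i (mon_wt n m)"
proof -
  let ?y = "Poly_Mapping.lookup m" and ?K = "Poly_Mapping.keys m"
  have "coroot_pairing i (mon_wt n m) = (\<Sum>p\<in>?K. ?y p * (if fst p mod n = i then 1 else 0))"
    by (simp add: coroot_pairing_def mon_wt_def frag_extend_def lookup_sum fund_weight_def
        lookup_single when_def case_prod_unfold eq_commute[of i])
  also have "\<dots> = (\<Sum>p\<in>Pair i ` {t. (i, t) \<in> ?K}. ?y p)"
    by (rule sum.mono_neutral_cong_right) (use assms in \<open>auto simp: monomials_def subset_iff\<close>)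
  also have "\<dots> = row_total m i"
    by (simp add: row_total_def sum.reindex inj_on_def)
  finally show ?thesis by simp
qed

lemma lower_sum_add: "lower_sum (m + m') i k = lower_sum m i k + lower_sum m' i k"
proof -
  obtain a b where 1: "\<And>k. k < a \<Longrightarrow> lower_sum m i k = 0"
    using lower_sum_bounds[of m i] by metis
  obtain a' b' where 2: "\<And>k. k < a' \<Longrightarrow> lower_sum m' i k = 0"
    using lower_sum_bounds[of m' i] by metis
  show ?thesis
  proof (rule lower_sum_unique)
    show "lower_sum m i k + lower_sum m' i k = lower_sum m i (k - 1) + lower_sum m' i (k - 1) +
        Poly_Mapping.lookup (m + m') (i, k)" for k
      using lower_sum_step[of m i k] lower_sum_step[of m' i k] by (simp add: lookup_add)
    show "lower_sum m i k + lower_sum m' i k = 0" if "k < min a a'" for k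
      using that 1[of k] 2[of k] by simp
  qed
qed

text \<open>On partial sums of row \<open>i\<close>, multiplication by \<open>Avar n i K\<close>
  adds the profile 0, 1, 2 with its step at \<open>K\<close>; both operators are analysed through
  it.\<close>

lemma lower_sum_Avar:
  assumes "3 \<le> n" "i \<in> idx n"
  shows "lower_sum (Avar n i K) i k = (if k < K then 0 else if k = K then 1 else 2)"
  by (rule lower_sum_unique[of _ _ _ K]) (auto simp: lookup_Avar_self[OF assms])

lemma lower_sum_diff: "lower_sum (m - m') i k = lower_sum m i k - lower_sum m' i k"
  using lower_sum_add[of "m - m'" m' i k] by simp

lemma eps_eq_phi_wt:
  assumes "m \<in> monomials n" "i \<in> idx n"
  shows "mon_eps i m = mon_phi i m - coroot_pairing i (mon_wt n m)"
  using assms by (simp add: eps_eq row_total_eq)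

lemma eps_ge_0: "0 \<le> mon_eps i m"
  using total_le_phi[of m i] by (simp add: eps_eq)

text \<open>\<open>K\<close> is the first maximum. Subtracting the profile leaves the sums before
  \<open>K\<close> at most \<open>mon_phi i m - 1\<close>, gives exactly this value at
  \<open>K\<close>, and less afterwards. So \<open>K\<close> is the last maximum of
  \<open>m'\<close>, and \<open>mon_e\<close> acts there.\<close>

lemma mon_f_SomeD:
  assumes "3 \<le> n" "i \<in> idx n" "m \<in> monomials n" "mon_f n i m = Some m'"
  shows "m' \<in> monomials n" "mon_wt n m' = mon_wt n m - simple_root n i"
    "mon_eps i m' = mon_eps i m + 1" "mon_phi i m' = mon_phi i m - 1" "mon_e n i m' = Some m"
proof -
  define K where "K = mon_kf i m"
  have nz: "mon_phi i m \<noteq> 0" and m': "m' = m - Avar n i K"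
    using assms(4) by (auto simp: mon_f_def K_def split: if_splits)
  have L': "lower_sum m' i k = lower_sum m i k - (if k < K then 0 else if k = K then 1 else 2)" for k
    by (simp add: m' lower_sum_diff lower_sum_Avar[OF assms(1,2)])
  note K = kf_props[OF nz, folded K_def]
  show in': "m' \<in> monomials n"
    unfolding m' using assms by (intro monomials_add monomials_diff monomials_Avar) auto
  show wt: "mon_wt n m' = mon_wt n m - simple_root n i"
    by (simp add: m' mon_wt_Avar[symmetric, of n i K] mon_wt_def frag_extend_diff)
  show phi: "mon_phi i m' = mon_phi i m - 1"
  proof (rule phi_eqI)
    show "lower_sum m' i k \<le> mon_phi i m - 1" for k
      using K(2)[of k] lower_sum_le_phi[of m i k] by (auto simp: L')
    show "lower_sum m' i K = mon_phi i m - 1" by (simp add: L' K)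
  qed
  show eps: "mon_eps i m' = mon_eps i m + 1"
    using in' assms
    by (simp add: eps_eq_phi_wt[of _ n] phi wt coroot_pairing_add coroot_pairing_simple_root)
  have "mon_ke i m' = K + 1"
  proof (rule ke_eqI)
    show "lower_sum m' i K = mon_phi i m'" by (simp add: L' K phi)
    show "lower_sum m' i k < mon_phi i m'" if "k > K" for k
      using lower_sum_le_phi[of m i k] that by (simp add: L' phi)
  qed
  then show "mon_e n i m' = Some m"
    using eps eps_ge_0[of i m] by (simp add: mon_e_def m')
qed

text \<open>Dually, adding the profile at the last maximum \<open>K\<close> turns \<open>K\<close>
  into the first maximum of \<open>m'\<close>.\<close>

lemma mon_e_SomeD:
  assumes "3 \<le> n" "i \<in> idx n" "m \<in> monomials n" "mon_e n i m = Some m'"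
  shows "m' \<in> monomials n" "mon_wt n m' = mon_wt n m + simple_root n i"
    "mon_eps i m' = mon_eps i m - 1" "mon_phi i m' = mon_phi i m + 1" "mon_f n i m' = Some m"
proof -
  define K where "K = mon_ke i m - 1"
  have nz: "mon_eps i m \<noteq> 0" and m': "m' = m + Avar n i K"
    using assms(4) by (auto simp: mon_e_def K_def split: if_splits)
  have L': "lower_sum m' i k = lower_sum m i k + (if k < K then 0 else if k = K then 1 else 2)" for k
    by (simp add: m' lower_sum_add lower_sum_Avar[OF assms(1,2)])
  note K = ke_props[OF nz, folded K_def]
  show in': "m' \<in> monomials n"
    unfolding m' using assms by (intro monomials_add monomials_diff monomials_Avar) auto
  show wt: "mon_wt n m' = mon_wt n m + simple_root n i"
    by (simp add: m' mon_wt_Avar[symmetric, of n i K] mon_wt_def frag_extend_add)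
  show phi: "mon_phi i m' = mon_phi i m + 1"
  proof (rule phi_eqI)
    show "lower_sum m' i k \<le> mon_phi i m + 1" for k
      using K(2)[of k] lower_sum_le_phi[of m i k] by (auto simp: L')
    show "lower_sum m' i K = mon_phi i m + 1" by (simp add: L' K)
  qed
  show eps: "mon_eps i m' = mon_eps i m - 1"
    using in' assms
    by (simp add: eps_eq_phi_wt[of _ n] phi wt coroot_pairing_add coroot_pairing_simple_root)
  have "mon_kf i m' = K"
  proof (rule kf_eqI)
    show "lower_sum m' i K = mon_phi i m'" by (simp add: L' K phi)
    show "lower_sum m' i k < mon_phi i m'" if "k < K" for k
      using lower_sum_le_phi[of m i k] that by (simp add: L' phi)
  qed
  then show "mon_f n i m' = Some m"
    using phi phi_ge_0[of i m] by (simp add: mon_f_def m')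
qed

section \<open>Crystal axioms for sets of monomials and for tensor products\<close>

text \<open>The equivalence between the two operators is split into one implication attached to
  \<open>e\<close> and one attached to \<open>f\<close>.\<close>

lemma is_crystalI:
  assumes wt: "\<And>b. b \<in> elems B \<Longrightarrow> cry_wt B b \<in> weight_lattice n"
    and phi: "\<And>i b. i \<in> idx n \<Longrightarrow> b \<in> elems B \<Longrightarrow>
      cry_phi B i b = cry_eps B i b + coroot_pairing i (cry_wt B b)"
    and e: "\<And>i b b'. i \<in> idx n \<Longrightarrow> b \<in> elems B \<Longrightarrow> cry_e B i b = Some b' \<Longrightarrow>
      b' \<in> elems B \<and> cry_wt B b' = cry_wt B b + simple_root n i \<and>
      cry_eps B i b' = cry_eps B i b - 1 \<and> cry_phi B i b' = cry_phi B i b + 1 \<and>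
      cry_f B i b' = Some b"
    and f: "\<And>i b b'. i \<in> idx n \<Longrightarrow> b \<in> elems B \<Longrightarrow> cry_f B i b = Some b' \<Longrightarrow>
      b' \<in> elems B \<and> cry_wt B b' = cry_wt B b - simple_root n i \<and>
      cry_eps B i b' = cry_eps B i b + 1 \<and> cry_phi B i b' = cry_phi B i b - 1 \<and>
      cry_e B i b' = Some b"
  shows "is_crystal n B"
  unfolding is_crystal_def
proof (intro conjI ballI allI impI)
  fix i b b'
  assume "i \<in> idx n" "b \<in> elems B" "b' \<in> elems B"
  then show "(cry_f B i b = Some b') = (cry_e B i b' = Some b)"
    using e[of i b' b] f[of i b b'] by argo
qed (use wt phi e f in \<open>meson\<close>)+

lemma is_crystalD:
  assumes "is_crystal n B" "b \<in> elems B"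
  shows is_crystal_wt: "cry_wt B b \<in> weight_lattice n"
    and is_crystal_phi: "i \<in> idx n \<Longrightarrow> cry_phi B i b = cry_eps B i b + coroot_pairing i (cry_wt B b)"
  by (fact conjunct1[OF assms(1)[unfolded is_crystal_def], rule_format, OF assms(2)]
    conjunct2[OF assms(1)[unfolded is_crystal_def], rule_format, OF _ assms(2), THEN conjunct1])+

lemma is_crystal_eD:
  assumes "is_crystal n B" "i \<in> idx n" "b \<in> elems B" "cry_e B i b = Some b'"
  shows "b' \<in> elems B \<and> cry_wt B b' = cry_wt B b + simple_root n i \<and>
      cry_eps B i b' = cry_eps B i b - 1 \<and> cry_phi B i b' = cry_phi B i b + 1 \<and>
      cry_f B i b' = Some b"
proof -
  note * = conjunct2[OF assms(1)[unfolded is_crystal_def], rule_format, OF assms(2)]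
  note e = *[OF assms(3), THEN conjunct2, THEN conjunct1, rule_format, OF assms(4)]
  have "cry_f B i b' = Some b"
    using *[OF conjunct1[OF e], THEN conjunct2, THEN conjunct2, THEN conjunct2, rule_format,
      OF assms(3)] assms(4) by (rule iffD2)
  then show ?thesis using e by iprover
qed

lemma is_crystal_fD:
  assumes "is_crystal n B" "i \<in> idx n" "b \<in> elems B" "cry_f B i b = Some b'"
  shows "b' \<in> elems B \<and> cry_wt B b' = cry_wt B b - simple_root n i \<and>
      cry_eps B i b' = cry_eps B i b + 1 \<and> cry_phi B i b' = cry_phi B i b - 1 \<and>
      cry_e B i b' = Some b"
proof -
  note * = conjunct2[OF assms(1)[unfolded is_crystal_def], rule_format, OF assms(2)]
  note f = *[OF assms(3), THEN conjunct2, THEN conjunct2, THEN conjunct1, rule_format, OF assms(4)]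
  have "cry_e B i b' = Some b"
    using *[OF assms(3), THEN conjunct2, THEN conjunct2, THEN conjunct2, rule_format,
      OF conjunct1[OF f]] assms(4) by (rule iffD1)
  then show ?thesis using f by iprover
qed

lemma is_crystal_monomial_crystal:
  assumes "3 \<le> n" "S \<subseteq> monomials n"
    and "\<And>m m' i. m \<in> S \<Longrightarrow> i \<in> idx n \<Longrightarrow> mon_e n i m = Some m' \<Longrightarrow> m' \<in> S"
    and "\<And>m m' i. m \<in> S \<Longrightarrow> i \<in> idx n \<Longrightarrow> mon_f n i m = Some m' \<Longrightarrow> m' \<in> S"
  shows "is_crystal n (monomial_crystal n S)"
proof (rule is_crystalI; unfold monomial_crystal_def crystal.simps)
  show "mon_wt n m \<in> weight_lattice n" for m
    using assms(1) by (simp add: mon_wt_in_lattice)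
  show "mon_phi i m = mon_eps i m + coroot_pairing i (mon_wt n m)" if "i \<in> idx n" "m \<in> S" for i m
    using that assms(2) by (simp add: eps_eq_phi_wt[of _ n] subset_iff)
qed (intro conjI; (erule (2) assms(3,4))?; erule (1) mon_e_SomeD[OF assms(1) _ subsetD[OF assms(2)]]
    mon_f_SomeD[OF assms(1) _ subsetD[OF assms(2)]]; assumption)+

text \<open>The inverse operator picks the same factor: after \<open>e\<close> on \<open>b2\<close>
  the strict inequality becomes the weak one required by \<open>f\<close>, and after
  \<open>e\<close> on \<open>b1\<close> the weak inequality becomes strict. The same holds with
  \<open>e\<close> and \<open>f\<close> exchanged.\<close>

lemma is_crystal_tensor:
  assumes "is_crystal n B2" "is_crystal n B1"
  shows "is_crystal n (tensor B2 B1)"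
proof -
  have wt: "cry_wt B2 b2 + cry_wt B1 b1 \<in> weight_lattice n"
    if "b2 \<in> elems B2" "b1 \<in> elems B1" for b2 b1
  proof -
    have "cry_wt B2 b2 \<in> weight_lattice n" "cry_wt B1 b1 \<in> weight_lattice n"
      using assms that by (auto intro: is_crystal_wt)
    then show ?thesis
      unfolding weight_lattice_def mem_Collect_eq by (meson keys_add order_trans Un_least)
  qed
  note phi2 = is_crystal_phi[OF assms(1)] and phi1 = is_crystal_phi[OF assms(2)]
    and e2 = is_crystal_eD[OF assms(1)] and e1 = is_crystal_eD[OF assms(2)]
    and f2 = is_crystal_fD[OF assms(1)] and f1 = is_crystal_fD[OF assms(2)]
  let ?T = "tensor B2 B1"
  have phiT: "cry_phi ?T i b = cry_eps ?T i b + coroot_pairing i (cry_wt ?T b)"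
    if "i \<in> idx n" "b \<in> elems ?T" for i b
    using that phi1 phi2 by (auto simp: tensor_def coroot_pairing_add)
  have eT: "b' \<in> elems ?T \<and> cry_wt ?T b' = cry_wt ?T b + simple_root n i \<and>
      cry_eps ?T i b' = cry_eps ?T i b - 1 \<and> cry_phi ?T i b' = cry_phi ?T i b + 1 \<and>
      cry_f ?T i b' = Some b"
    if i: "i \<in> idx n" and b: "b \<in> elems ?T" and e: "cry_e ?T i b = Some b'" for i b b'
  proof -
    obtain b2 b1 where [simp]: "b = (b2, b1)" by force
    have mem: "b2 \<in> elems B2" "b1 \<in> elems B1" using b by (auto simp: tensor_def)
    show ?thesis
    proof (cases "cry_eps B2 i b2 > cry_phi B1 i b1")
      case True
      then obtain c where c: "cry_e B2 i b2 = Some c" and [simp]: "b' = (c, b1)"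
        using e by (auto simp: tensor_def)
      show ?thesis
        using True mem e2[OF i mem(1) c] phi1[OF mem(2) i] phi2[OF mem(1) i]
          phi2[OF _ i, of c]
        by (auto simp: tensor_def coroot_pairing_add)
    next
      case False
      then obtain c where c: "cry_e B1 i b1 = Some c" and [simp]: "b' = (b2, c)"
        using e by (auto simp: tensor_def)
      show ?thesis
        using False mem e1[OF i mem(2) c] phi1[OF mem(2) i] phi2[OF mem(1) i]
          phi1[OF _ i, of c]
        by (auto simp: tensor_def coroot_pairing_add)
    qed
  qed
  have fT: "b' \<in> elems ?T \<and> cry_wt ?T b' = cry_wt ?T b - simple_root n i \<and>
      cry_eps ?T i b' = cry_eps ?T i b + 1 \<and> cry_phi ?T i b' = cry_phi ?T i b - 1 \<and>
      cry_e ?T i b' = Some b"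
    if i: "i \<in> idx n" and b: "b \<in> elems ?T" and f: "cry_f ?T i b = Some b'" for i b b'
  proof -
    obtain b2 b1 where [simp]: "b = (b2, b1)" by force
    have mem: "b2 \<in> elems B2" "b1 \<in> elems B1" using b by (auto simp: tensor_def)
    show ?thesis
    proof (cases "cry_eps B2 i b2 \<ge> cry_phi B1 i b1")
      case True
      then obtain c where c: "cry_f B2 i b2 = Some c" and [simp]: "b' = (c, b1)"
        using f by (auto simp: tensor_def)
      show ?thesis
        using True mem f2[OF i mem(1) c] phi1[OF mem(2) i] phi2[OF mem(1) i]
          phi2[OF _ i, of c]
        by (auto simp: tensor_def coroot_pairing_add)
    next
      case False
      then obtain c where c: "cry_f B1 i b1 = Some c" and [simp]: "b' = (b2, c)"
        using f by (auto simp: tensor_def)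
      show ?thesis
        using False mem f1[OF i mem(2) c] phi1[OF mem(2) i] phi2[OF mem(1) i]
          phi1[OF _ i, of c]
        by (auto simp: tensor_def coroot_pairing_add)
    qed
  qed
  have wtT: "cry_wt ?T b \<in> weight_lattice n" if "b \<in> elems ?T" for b
    using that wt by (auto simp: tensor_def)
  show ?thesis
    by (rule is_crystalI) (use wtT phiT eT fT in meson)+
qed
section \<open>Patterns and the paths they encode\<close>

text \<open>Functions on residues are modelled as periodic functions of an integer, so shifted
  indices need no reduction.\<close>

definition cyclic :: "int \<Rightarrow> (int \<Rightarrow> 'a) \<Rightarrow> bool" where
  "cyclic n g \<longleftrightarrow> (\<forall>i. g (i mod n) = g i)"

lemma cyclic_cong: "cyclic n g \<Longrightarrow> i mod n = j mod n \<Longrightarrow> g i = g j"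
  unfolding cyclic_def by metis

lemma cyclic_comp_add: "cyclic n g \<Longrightarrow> cyclic n (\<lambda>i. g (i + d))"
  by (auto simp: cyclic_def[of n "\<lambda>i. g (i + d)"] mod_add_left_eq intro: cyclic_cong)

lemma sum_cyclic_interval:
  assumes "0 < n" "cyclic n g"
  shows "sum g {1..n} = sum g (idx n)"
proof -
  have "{1..n} = insert n {1..<n}" "idx n = insert 0 {1..<n}"
    using assms(1) by (auto simp: idx_def)
  moreover have "g n = g 0" by (rule cyclic_cong[OF assms(2)]) simp
  ultimately show ?thesis by simp
qed

lemma sum_cyclic_shift:
  assumes "0 < n" "cyclic n g"
  shows "(\<Sum>i\<in>idx n. g (i + 1)) = sum g (idx n)"
proof -
  have "(\<Sum>i\<in>idx n. g (i + 1)) = sum g {1..n}"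
    by (rule sum.reindex_bij_witness[of _ "\<lambda>i. i - 1" "\<lambda>i. i + 1"]) (auto simp: idx_def)
  then show ?thesis using sum_cyclic_interval[OF assms] by simp
qed

lemma finite_idx [simp]: "finite (idx n)"
  by (simp add: idx_def)

lemma pred_mod_eq_iff:
  fixes n :: int
  assumes "i \<in> idx n" "j \<in> idx n"
  shows "(i - 1) mod n = j \<longleftrightarrow> (j + 1) mod n = i"
proof -
  have "(i - 1) mod n = j mod n \<longleftrightarrow> (j + 1) mod n = i mod n"
    by (simp add: mod_eq_dvd_iff) (metis dvd_minus_iff diff_diff_eq2 minus_diff_eq add.commute diff_add_eq)
  then show ?thesis using assms by simp
qed

text \<open>One application of an operator at \<open>K\<close> changes a single residue of row
  \<open>K\<close>: \<open>d = 1\<close> for \<open>f\<close> and \<open>d = -1\<close> for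
  \<open>e\<close>.\<close>

definition bump :: "int \<Rightarrow> int \<Rightarrow> int \<Rightarrow> int \<Rightarrow> (int \<Rightarrow> int \<Rightarrow> int) \<Rightarrow> int \<Rightarrow> int \<Rightarrow> int" where
  "bump n K i d c = (\<lambda>k j. c k j + (if k = K \<and> j mod n = i then d else 0))"

text \<open>\<open>c k i\<close> is the exponent of \<open>A\<^bsub>i,k\<^esub>\<^sup>-\<^sup>1\<close>, and \<open>letter l c k i\<close> is the multiplicity \<open>x\<^sub>i\<close> of the factor
  \<open>m\<^sub>k\<close>.  In \<open>represents\<close>, the exponents of \<open>Y\<^sub>\<lambda> \<Prod> A\<^bsub>i,k\<^esub>\<^bsup>-c(k,i)\<^esup>\<close> are written out.\<close>

definition letter :: "(int \<Rightarrow> int) \<Rightarrow> (int \<Rightarrow> int \<Rightarrow> int) \<Rightarrow> int \<Rightarrow> int \<Rightarrow> int" where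
  "letter l c k i = l (i + k) - c k i + c k (i - 1)"

text \<open>From row \<open>N\<close> on the letters are the ground state \<open>l (i + k)\<close>.
  Rows with negative \<open>k\<close> are zero, so row \<open>k - 1\<close> may be mentioned at
  \<open>k = 0\<close>.\<close>

definition pattern :: "int \<Rightarrow> (int \<Rightarrow> int) \<Rightarrow> int \<Rightarrow> (int \<Rightarrow> int \<Rightarrow> int) \<Rightarrow> bool" where
  "pattern n l N c \<longleftrightarrow> cyclic n l \<and> (\<forall>k. cyclic n (c k)) \<and>
     (\<forall>k i. k < 0 \<or> N \<le> k \<longrightarrow> c k i = 0) \<and> (\<forall>k i. 0 \<le> k \<longrightarrow> 0 \<le> letter l c k i)"

definition represents :: "int \<Rightarrow> (int \<Rightarrow> int) \<Rightarrow> (int \<Rightarrow> int \<Rightarrow> int) \<Rightarrow> monomial \<Rightarrow> bool" where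
  "represents n l c m \<longleftrightarrow> m \<in> monomials n \<and>
     (\<forall>i\<in>idx n. \<forall>k. Poly_Mapping.lookup m (i, k) =
        (if k = 0 then l i else 0) - c k i + c k (i - 1) - c (k - 1) i + c (k - 1) (i + 1))"

text \<open>The ground state terms of \<open>letter l c k i\<close> and
  \<open>letter l c (k - 1) (i + 1)\<close> are both \<open>l (i + k)\<close> and cancel. The
  formula displays \<open>m\<close> as a product of shifted one-row monomials.\<close>

lemma lookup_represents:
  assumes "pattern n l N c" "represents n l c m" "i \<in> idx n"
  shows "Poly_Mapping.lookup m (i, k) =
    (if k < 0 then 0 else if k = 0 then letter l c 0 i
     else letter l c k i - letter l c (k - 1) (i + 1))"
proof -
  have z: "c t j = 0" if "t < 0" for t j
    using assms(1) that by (simp add: pattern_def)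
  have "Poly_Mapping.lookup m (i, k) =
      (if k = 0 then l i else 0) - c k i + c k (i - 1) - c (k - 1) i + c (k - 1) (i + 1)"
    using assms(2,3) by (simp add: represents_def)
  then show ?thesis
    by (simp add: letter_def z)
qed

lemma cyclic_letter: "pattern n l N c \<Longrightarrow> cyclic n (letter l c k)"
  unfolding cyclic_def
proof
  fix i
  assume p: "pattern n l N c"
  then have "l (i mod n + k) = l (i + k)"
    by (intro cyclic_cong[of n l]) (auto simp: pattern_def mod_add_left_eq)
  moreover have "c k (i mod n) = c k i" "c k (i mod n - 1) = c k (i - 1)"
    using p by (auto simp: pattern_def mod_diff_left_eq intro!: cyclic_cong[of n "c k"])
  ultimately show "letter l c k (i mod n) = letter l c k i"
    by (simp add: letter_def)
qed

lemma represents_bump: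
  assumes "represents n l c m" "i \<in> idx n" "0 < n"
  shows "represents n l (bump n K i d c) (m - frag_cmul d (Avar n i K))"
  unfolding represents_def
proof (intro conjI ballI allI)
  show "m - frag_cmul d (Avar n i K) \<in> monomials n"
    using assms by (intro monomials_diff monomials_cmul monomials_Avar) (auto simp: represents_def)
  fix j k
  assume j: "j \<in> idx n"
  \<comment> \<open>\<open>Avar\<close> refers to the neighbours of \<open>i\<close>, the pattern
    formula to those of \<open>j\<close>; these equivalences match them.\<close>
  have [simp]: "(j - 1) mod n = i \<longleftrightarrow> (i + 1) mod n = j"
    and [simp]: "(i - 1) mod n = j \<longleftrightarrow> (j + 1) mod n = i"
    using assms(2) j pred_mod_eq_iff by blast+
  have "Poly_Mapping.lookup (m - frag_cmul d (Avar n i K)) (j, k) =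
     Poly_Mapping.lookup m (j, k) - d * ((if i = j \<and> K = k then 1 else 0) +
       (if i = j \<and> K + 1 = k then 1 else 0) - (if (i - 1) mod n = j \<and> K + 1 = k then 1 else 0) -
       (if (i + 1) mod n = j \<and> K = k then 1 else 0))"
    using assms(2) by (simp add: lookup_minus lookup_add Avar_def lookup_Yvar)
  also have "Poly_Mapping.lookup m (j, k) =
      (if k = 0 then l j else 0) - c k j + c k (j - 1) - c (k - 1) j + c (k - 1) (j + 1)"
    using assms(1) j by (simp add: represents_def)
  finally show "Poly_Mapping.lookup (m - frag_cmul d (Avar n i K)) (j, k) =
    (if k = 0 then l j else 0) - bump n K i d c k j + bump n K i d c k (j - 1)
      - bump n K i d c (k - 1) j + bump n K i d c (k - 1) (j + 1)"
    using j assms(2) by (auto simp: bump_def)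
qed

lemma letter_bump:
  "letter l (bump n K i d c) k j = letter l c k j
     - (if k = K \<and> j mod n = i then d else 0) + (if k = K \<and> (j - 1) mod n = i then d else 0)"
  by (simp add: letter_def bump_def)

text \<open>Only letters of row \<open>K\<close> change, at the residues of \<open>i\<close> and
  \<open>i + 1\<close>; the last assumption is the nonnegativity of the new row.\<close>

lemma pattern_bump:
  assumes "pattern n l N c" "0 \<le> K" "K < N'" "N \<le> N'"
    and "\<And>j. (if j mod n = i then d else 0) \<le> letter l c K j + (if (j - 1) mod n = i then d else 0)"
  shows "pattern n l N' (bump n K i d c)"
proof -
  have "cyclic n (bump n K i d c k)" for k
    using assms(1) by (auto simp: pattern_def cyclic_def bump_def)
  moreover have "0 \<le> letter l (bump n K i d c) k j" if "0 \<le> k" for k j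
    using assms(1) assms(5)[of j] that by (auto simp: letter_bump pattern_def)
  ultimately show ?thesis
    using assms by (auto simp: pattern_def bump_def)
qed

text \<open>The sums drop after the last maximum \<open>K\<close>, so the exponent at
  \<open>K + 1\<close> is negative. Being
  \<open>letter l c (K + 1) i - letter l c K (i + 1)\<close>, it forces the second letter to be
  positive, so a unit can move from \<open>i + 1\<close> back to \<open>i\<close>.\<close>

lemma represents_e:
  assumes n: "3 \<le> n" and i: "i \<in> idx n" and p: "pattern n l N c" and r: "represents n l c m"
    and e: "mon_e n i m = Some m'"
  obtains K where "0 \<le> K" "K < N" "Poly_Mapping.lookup m (i, K + 1) < 0"
    "pattern n l N (bump n K i (-1) c)" "represents n l (bump n K i (-1) c) m'"
proof -
  define K where "K = mon_ke i m - 1"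
  have nz: "mon_eps i m \<noteq> 0" and m': "m' = m + Avar n i K"
    using e by (auto simp: mon_e_def K_def split: if_splits)
  have neg: "Poly_Mapping.lookup m (i, K + 1) < 0"
    using ke_props(1) ke_props(2)[of i m "K + 1"] lower_sum_step[of m i "K + 1"] nz
    by (simp add: K_def)
  note lk = lookup_represents[OF p r i, of "K + 1"]
  have pos: "0 \<le> letter l c k j" if "0 \<le> k" for k j
    using p that by (simp add: pattern_def)
  have K0: "0 \<le> K"
    using neg lk pos[of 0 i] by (auto split: if_splits)
  then have gt: "0 < letter l c K (i + 1)"
    using neg lk pos[of "K + 1" i] by simp
  \<comment> \<open>Past \<open>N\<close> both letters are ground state values with the same
    argument, and the exponent would be 0.\<close>
  have KN: "K < N"
  proof (rule ccontr)
    assume "\<not> K < N"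
    then have "letter l c (K + 1) i = letter l c K (i + 1)"
      using p by (simp add: pattern_def letter_def algebra_simps)
    then show False using neg lk K0 by simp
  qed
  have "pattern n l N (bump n K i (-1) c)"
  proof (rule pattern_bump[OF p K0 KN order_refl])
    fix j
    have "letter l c K j = letter l c K (i + 1)" if "(j - 1) mod n = i"
      using cyclic_cong[OF cyclic_letter[OF p], of j "i + 1"] that
      by (metis add.commute diff_add_cancel mod_add_right_eq)
    then show "(if j mod n = i then - 1 else 0) \<le> letter l c K j + (if (j - 1) mod n = i then - 1 else 0)"
      using gt pos[OF K0, of j] by auto
  qed
  moreover have "represents n l (bump n K i (-1) c) m'"
    using represents_bump[OF r i, of K "-1"] n by (simp add: m')
  ultimately show thesis using that K0 KN neg by blast
qed

text \<open>The sums rise at the first maximum \<open>K\<close>, so the exponent there is positive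
  and \<open>letter l c K i\<close> can be lowered. \<open>K\<close> may lie beyond
  \<open>N\<close>, whence the new bound.\<close>

lemma represents_f:
  assumes n: "3 \<le> n" and i: "i \<in> idx n" and p: "pattern n l N c" and r: "represents n l c m"
    and f: "mon_f n i m = Some m'"
  obtains K where "pattern n l (max N (K + 1)) (bump n K i 1 c)" "represents n l (bump n K i 1 c) m'"
proof -
  define K where "K = mon_kf i m"
  have nz: "mon_phi i m \<noteq> 0" and m': "m' = m - Avar n i K"
    using f by (auto simp: mon_f_def K_def split: if_splits)
  have y: "0 < Poly_Mapping.lookup m (i, K)"
    using kf_props(1) kf_props(2)[of i m "K - 1"] lower_sum_step[of m i K] nz
    by (simp add: K_def)
  note lk = lookup_represents[OF p r i, of K]
  have pos: "0 \<le> letter l c k j" if "0 \<le> k" for k j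
    using p that by (simp add: pattern_def)
  have K0: "0 \<le> K" using y lk by (simp split: if_splits)
  have gt: "0 < letter l c K i"
  proof (cases "K = 0")
    case False
    then show ?thesis using y lk K0 pos[of "K - 1" "i + 1"] by simp
  qed (use y lk in simp)
  have "pattern n l (max N (K + 1)) (bump n K i 1 c)"
  proof (rule pattern_bump[OF p K0])
    fix j
    have "letter l c K j = letter l c K i" if "j mod n = i"
      using cyclic_cong[OF cyclic_letter[OF p], of j i] that i by simp
    then show "(if j mod n = i then 1 else 0) \<le> letter l c K j + (if (j - 1) mod n = i then 1 else 0)"
      using gt pos[OF K0, of j] by auto
  qed auto
  moreover have "represents n l (bump n K i 1 c) m'"
    using represents_bump[OF r i, of K 1] n by (simp add: m')
  ultimately show thesis using that by blast
qed

section \<open>The generated set \<open>M_of\<close> described by patterns\<close>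

definition weight_coeff :: "int \<Rightarrow> weight \<Rightarrow> int \<Rightarrow> int" where
  "weight_coeff n w i = coroot_pairing (i mod n) w"

lemma cyclic_weight_coeff: "cyclic n (weight_coeff n w)"
  by (simp add: cyclic_def weight_coeff_def)

lemma represents_Y_weight: "0 < n \<Longrightarrow> represents n (weight_coeff n w) (\<lambda>_ _. 0) (Y_weight n w)"
proof -
  assume n: "0 < n"
  have "Poly_Mapping.lookup (Y_weight n w) (i, k) = (if k = 0 then weight_coeff n w i else 0)"
    if "i \<in> idx n" for i k
  proof -
    have "Poly_Mapping.lookup (Y_weight n w) (i, k) =
        (\<Sum>j\<in>idx n. if j = i then (if k = 0 then weight_coeff n w j else 0) else 0)"
      unfolding Y_weight_def lookup_sum
      by (rule sum.cong) (auto simp: lookup_Yvar weight_coeff_def)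
    then show ?thesis using that by simp
  qed
  moreover have "Y_weight n w \<in> monomials n"
    unfolding Y_weight_def using n by (intro monomials_sum monomials_cmul monomials_Yvar)
  ultimately show ?thesis by (simp add: represents_def)
qed

lemma pattern_ground: "dominant n w \<Longrightarrow> 0 < n \<Longrightarrow> pattern n (weight_coeff n w) 0 (\<lambda>_ _. 0)"
  by (auto simp: pattern_def letter_def cyclic_weight_coeff dominant_def weight_coeff_def cyclic_def)

lemma M_of_represents:
  assumes "3 \<le> n" "dominant n w" "m \<in> M_of n w"
  shows "\<exists>N c. pattern n (weight_coeff n w) N c \<and> represents n (weight_coeff n w) c m"
  using assms(3)
proof induction
  case base
  then show ?case
    using pattern_ground[OF assms(2)] represents_Y_weight[of n w] assms(1) by fastforce
next
  case (step_e m i m')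
  then show ?case using represents_e[OF assms(1) step_e(2)] by metis
next
  case (step_f m i m')
  then show ?case using represents_f[OF assms(1) step_f(2)] by metis
qed

lemma lower_sum_eq_row_total:
  assumes "\<And>t. k < t \<Longrightarrow> Poly_Mapping.lookup m (i, t) = 0"
  shows "lower_sum m i k = row_total m i"
proof -
  have "{t. t \<le> k \<and> (i, t) \<in> Poly_Mapping.keys m} = {t. (i, t) \<in> Poly_Mapping.keys m}"
    using assms by (auto simp: in_keys_iff intro!: leI)
  then show ?thesis by (simp add: lower_sum_def row_total_def)
qed

lemma lower_sum_eq_0:
  assumes "\<And>t. t \<le> k \<Longrightarrow> Poly_Mapping.lookup m (i, t) = 0"
  shows "lower_sum m i k = 0"
  unfolding lower_sum_def by (rule sum.neutral) (use assms in blast)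

text \<open>Each of the two columns met by an \<open>Avar\<close> contains one factor and one
  inverse factor, so every column sum is that of the starting monomial.\<close>

lemma sum_lookup_represents:
  assumes "0 < n" "pattern n l N c" "represents n l c m"
  shows "(\<Sum>i\<in>idx n. Poly_Mapping.lookup m (i, k)) = (if k = 0 then sum l (idx n) else 0)"
proof -
  have cyc: "cyclic n (c t)" for t using assms(2) by (simp add: pattern_def)
  have 1: "(\<Sum>i\<in>idx n. c t (i + 1)) = sum (c t) (idx n)" for t
    by (rule sum_cyclic_shift[OF assms(1) cyc])
  have 2: "(\<Sum>i\<in>idx n. c t (i - 1)) = sum (c t) (idx n)" for t
    using sum_cyclic_shift[OF assms(1) cyclic_comp_add[OF cyc, of t "-1"]] by simp
  have "(\<Sum>i\<in>idx n. Poly_Mapping.lookup m (i, k)) = (\<Sum>i\<in>idx n. (if k = 0 then l i else 0)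
      - c k i + c k (i - 1) - c (k - 1) i + c (k - 1) (i + 1))"
    using assms(3) by (intro sum.cong) (auto simp: represents_def)
  then show ?thesis
    by (simp add: sum.distrib sum_subtractf 1 2)
qed

text \<open>If every \<open>\<epsilon>\<^sub>i\<close> vanishes then each partial sum is bounded by the full row sum; summed over \<open>i\<close>
  both sides agree, since each letter has the same number of entries.  So all these bounds are
  equalities.\<close>

lemma highest_weight_unique:
  assumes n: "0 < n" and p: "pattern n l N c" and r: "represents n l c m"
    and eps: "\<And>i. i \<in> idx n \<Longrightarrow> mon_eps i m = 0"
  shows "represents n l (\<lambda>_ _. 0) m"
proof -
  let ?y = "\<lambda>i k. Poly_Mapping.lookup m (i, k)" and ?L = "lower_sum m"
  note lk = lookup_represents[OF p r]
  have sumL: "(\<Sum>i\<in>idx n. ?L i k) = sum l (idx n)" if "0 \<le> k" for k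
    using that
  proof (induction k rule: int_ge_induct)
    case base
    have "(\<Sum>i\<in>idx n. ?L i 0) = (\<Sum>i\<in>idx n. ?y i 0)"
    proof (rule sum.cong[OF refl])
      fix i assume "i \<in> idx n"
      then have "?L i (0 - 1) = 0" by (intro lower_sum_eq_0) (simp add: lk)
      then show "?L i 0 = ?y i 0" using lower_sum_step[of m i 0] by simp
    qed
    then show ?case using sum_lookup_represents[OF n p r, of 0] by simp
  next
    case (step k)
    have "(\<Sum>i\<in>idx n. ?L i (k + 1)) = (\<Sum>i\<in>idx n. ?L i k) + (\<Sum>i\<in>idx n. ?y i (k + 1))"
      using lower_sum_step[of m _ "k + 1"] by (simp add: sum.distrib)
    then show ?case using step sum_lookup_represents[OF n p r, of "k + 1"] by simp
  qed
  \<comment> \<open>The exponent in column \<open>t\<close> involves rows \<open>t\<close> and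
    \<open>t - 1\<close>; for \<open>t\<close> strictly beyond \<open>max 0 N\<close> both are
    ground state rows and cancel.\<close>
  have tot: "?L i (max 0 N) = row_total m i" if "i \<in> idx n" for i
  proof (rule lower_sum_eq_row_total)
    fix t assume "max 0 N < t"
    then show "?y i t = 0" using p lk[OF that, of t] by (simp add: pattern_def letter_def)
  qed
  have "(\<Sum>i\<in>idx n. row_total m i) = sum l (idx n)"
    using sumL[of "max 0 N"] tot by simp
  moreover have "?L i k \<le> row_total m i" if "i \<in> idx n" for i k
    using lower_sum_le_phi[of m i k] eps[OF that] by (simp add: eps_eq)
  ultimately have "?L i k = row_total m i" if "i \<in> idx n" "0 \<le> k" for i k
    using that sumL[of k] by (intro sum_mono_inv[of "\<lambda>i. ?L i k" "idx n"]) simp_all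
  then have y0: "?y i k = 0" if "i \<in> idx n" "0 < k" for i k
    using lower_sum_step[of m i k] that by simp
  \<comment> \<open>A vanishing exponent says that consecutive letters are shifts of each
    other.\<close>
  have letter_step: "letter l c k i = letter l c (k - 1) (i + 1)" if "0 < k" for k i
  proof -
    have "letter l c k (i mod n) = letter l c (k - 1) (i mod n + 1)"
      using y0[of "i mod n" k] lk[of "i mod n" k] n that by simp
    then show ?thesis
      using cyclic_cong[OF cyclic_letter[OF p], of "i mod n" i k]
        cyclic_cong[OF cyclic_letter[OF p], of "i mod n + 1" "i + 1" "k - 1"]
      by (simp add: mod_add_left_eq)
  qed
  have shift: "letter l c k i = letter l c 0 (i + k)" if "0 \<le> k" for k i
    using that
  proof (induction k arbitrary: i rule: int_ge_induct)
    case (step k)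
    then show ?case using letter_step[of "k + 1" i] by (simp add: algebra_simps)
  qed simp
  \<comment> \<open>Row 0 is compared with a row past \<open>N\<close>, whose letters are known to
    be the ground state.\<close>
  have "letter l c 0 i = l i" for i
  proof -
    have "letter l c (max 0 N) (i - max 0 N) = l i"
      using p by (simp add: pattern_def letter_def)
    then show ?thesis using shift[of "max 0 N" "i - max 0 N"] by simp
  qed
  then have "?y i k = (if k = 0 then l i else 0)" if "i \<in> idx n" for i k
    using lk[OF that, of k] y0[OF that, of k] by auto
  then show ?thesis using r by (auto simp: represents_def)
qed

text \<open>The shift in \<open>i\<close> compares positions with the same ground state value
  \<open>l (i + k)\<close>.\<close>

definition staircase :: "(int \<Rightarrow> int \<Rightarrow> int) \<Rightarrow> bool" where
  "staircase c \<longleftrightarrow> (\<forall>k i. 0 \<le> k \<longrightarrow> 0 \<le> c k i \<and> c (k + 1) i \<le> c k (i + 1))"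

text \<open>A pattern is only determined up to adding a constant to each of its rows, because
  \<open>\<Prod>\<^sub>i A\<^bsub>i,k\<^esub> = 1\<close>.  Constants that decrease fast enough in \<open>k\<close> give a staircase.\<close>

lemma staircase_exists:
  assumes n: "0 < n" and p: "pattern n l N c" and r: "represents n l c m"
  obtains c' where "pattern n l N c'" "represents n l c' m" "staircase c'"
proof -
  define B where "B = (\<Sum>k\<in>{0..<N}. \<Sum>i\<in>idx n. \<bar>c k i\<bar>)"
  have B: "\<bar>c k i\<bar> \<le> B" if "0 \<le> k" "k < N" for k i
  proof -
    have "c k i = c k (i mod n)" using p by (simp add: pattern_def cyclic_def)
    also have "\<bar>c k (i mod n)\<bar> \<le> (\<Sum>i\<in>idx n. \<bar>c k i\<bar>)"
      using n by (intro member_le_sum) auto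
    also have "\<dots> \<le> B"
      unfolding B_def using that by (intro member_le_sum) (auto intro: sum_nonneg)
    finally show ?thesis .
  qed
  have "0 \<le> B" unfolding B_def by (intro sum_nonneg) simp
  have z: "c k i = 0" if "k < 0 \<or> N \<le> k" for k i using p that by (auto simp: pattern_def)
  \<comment> \<open>With entries bounded by \<open>B\<close>, a drop of \<open>2 * B\<close> per row
    absorbs the difference of any two entries in adjacent rows, and the last shifted row still has
    \<open>2 * B\<close> added.\<close>
  define C where "C k = (if 0 \<le> k \<and> k < N then 2 * B * (N - k) else 0)" for k
  define c' where "c' k i = c k i + C k" for k i
  have lt: "letter l c' k i = letter l c k i" for k i
    by (simp add: letter_def c'_def)
  have "pattern n l N c'"
    using p by (auto simp: pattern_def lt) (auto simp: c'_def C_def cyclic_def)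
  moreover have "represents n l c' m"
    using r by (simp add: represents_def c'_def)
  moreover have "staircase c'"
    unfolding staircase_def
  proof (intro allI impI)
    fix k i :: int
    assume k: "0 \<le> k"
    have mul: "2 * B \<le> 2 * B * (N - k)" if "k < N"
      using mult_left_mono[of 1 "N - k" "2 * B"] \<open>0 \<le> B\<close> that by simp
    have "0 \<le> c' k i"
      using k B[of k i] mul z[of k i] by (auto simp: c'_def C_def)
    moreover have "c' (k + 1) i \<le> c' k (i + 1)"
    proof (cases "k + 1 < N")
      case True
      then have "C k = 2 * B + C (k + 1)"
        using k by (simp add: C_def algebra_simps)
      then show ?thesis using k True B[of k "i + 1"] B[of "k + 1" i] by (simp add: c'_def)
    next
      case False
      then have "c' (k + 1) i = 0" by (simp add: c'_def C_def z)
      moreover have "0 \<le> c' k (i + 1)"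
        using k B[of k "i + 1"] mul z[of k "i + 1"] by (auto simp: c'_def C_def)
      ultimately show ?thesis by simp
    qed
    ultimately show "0 \<le> c' k i \<and> c' (k + 1) i \<le> c' k (i + 1)" by simp
  qed
  ultimately show thesis using that by blast
qed

lemma represents_eqI:
  assumes "represents n l c m" "represents n l c m'"
  shows "m = m'"
  by (rule monomials_eqI[of _ n]) (use assms in \<open>auto simp: represents_def\<close>)

text \<open>Applying some \<open>e\<^sub>i\<close> keeps the staircase condition and removes one box from it.\<close>

lemma staircase_in_M_of:
  assumes "3 \<le> n" "pattern n (weight_coeff n w) N c" "represents n (weight_coeff n w) c m"
    and "staircase c"
  shows "m \<in> M_of n w"
  using assms(2-)
proof (induction "nat (\<Sum>(k, i)\<in>{0..<N} \<times> idx n. c k i)" arbitrary: c m rule: less_induct)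
  case less
  let ?l = "weight_coeff n w"
  note p = less.prems(1) and r = less.prems(2)
  have stair: "0 \<le> c k i" "c (k + 1) i \<le> c k (i + 1)" if "0 \<le> k" for k i
    using less.prems(3) that by (auto simp: staircase_def)
  show ?case
  proof (cases "\<forall>i\<in>idx n. mon_eps i m = 0")
    case True
    then have "represents n ?l (\<lambda>_ _. 0) m"
      using assms(1) by (intro highest_weight_unique[OF _ p r]) auto
    then have "m = Y_weight n w"
      using assms(1) by (intro represents_eqI[OF _ represents_Y_weight]) auto
    then show ?thesis by (simp add: M_of.base)
  next
    case False
    then obtain i where i: "i \<in> idx n" "mon_eps i m \<noteq> 0" by blast
    then obtain m' where e: "mon_e n i m = Some m'" by (simp add: mon_e_def)
    obtain K where K: "0 \<le> K" "K < N" and neg: "Poly_Mapping.lookup m (i, K + 1) < 0"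
      and p': "pattern n ?l N (bump n K i (-1) c)"
      and r': "represents n ?l (bump n K i (-1) c) m'"
      using represents_e[OF assms(1) i(1) p r e] .
    have "c K (i + 1) - c (K + 1) i + c (K + 1) (i - 1) < c K i"
      using neg r i(1) K by (simp add: represents_def)
    \<comment> \<open>The staircase inequality above the box to be removed is strict, so lowering
      \<open>c K i\<close> preserves it; in particular \<open>c K i\<close> is positive.\<close>
    then have gt: "c (K + 1) (i - 1) < c K i" using stair(2)[OF K(1), of i] by simp
    have eq: "c k j = c k i" if "j mod n = i" for k j
      using p that i(1) by (intro cyclic_cong[of n "c k"]) (auto simp: pattern_def)
    have st: "staircase (bump n K i (-1) c)"
      unfolding staircase_def
    proof (intro allI impI)
      fix k j :: int
      assume k: "0 \<le> k"
      have "c (K + 1) j = c (K + 1) (i - 1)" if "(j + 1) mod n = i"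
      proof (rule cyclic_cong[of n "c (K + 1)"])
        show "cyclic n (c (K + 1))" using p by (simp add: pattern_def)
        show "j mod n = (i - 1) mod n"
          using that by (metis add_diff_cancel_right' mod_diff_left_eq)
      qed
      then show "0 \<le> bump n K i (-1) c k j \<and>
          bump n K i (-1) c (k + 1) j \<le> bump n K i (-1) c k (j + 1)"
        using stair[OF k, of j] stair(1)[of "K + 1" "i - 1"] gt K eq[of j K] eq[of "j + 1" K]
        by (auto simp: bump_def)
    qed
    \<comment> \<open>\<open>i'\<close> is a copy of the fixed \<open>i\<close>, whose name is
      captured by the bound variable of the sum.\<close>
    have "(\<Sum>(k, i)\<in>{0..<N} \<times> idx n. bump n K i' (-1) c k i) < (\<Sum>(k, i)\<in>{0..<N} \<times> idx n. c k i)"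
      if "i' = i" for i'
      by (rule sum_strict_mono_ex1) (use K i that in \<open>auto simp: bump_def\<close>)
    moreover have "0 \<le> (\<Sum>(k, i)\<in>{0..<N} \<times> idx n. bump n K i' (-1) c k i)" if "i' = i" for i'
      by (rule sum_nonneg) (use st that in \<open>auto simp: staircase_def\<close>)
    ultimately have "m' \<in> M_of n w"
      by (intro less.hyps[OF _ p' r' st]) simp
    moreover have "mon_f n i m' = Some m"
      using r by (intro mon_e_SomeD(5)[OF assms(1) i(1) _ e]) (simp add: represents_def)
    ultimately show ?thesis using i(1) by (rule_tac M_of.step_f)
  qed
qed

text \<open>Membership no longer mentions the operators, so a product can be placed in
  \<open>M_of\<close> by exhibiting a pattern.\<close>

lemma M_of_iff:
  assumes "3 \<le> n" "dominant n w"
  shows "m \<in> M_of n w \<longleftrightarrow>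
    (\<exists>N c. pattern n (weight_coeff n w) N c \<and> represents n (weight_coeff n w) c m)"
proof
  show "m \<in> M_of n w"
    if ex: "\<exists>N c. pattern n (weight_coeff n w) N c \<and> represents n (weight_coeff n w) c m"
  proof -
    obtain N c where "pattern n (weight_coeff n w) N c" "represents n (weight_coeff n w) c m"
      using ex by blast
    then obtain c' where "pattern n (weight_coeff n w) N c'" "represents n (weight_coeff n w) c' m"
      "staircase c'"
      using staircase_exists[of n "weight_coeff n w" N c m] assms(1) by force
    then show ?thesis by (rule staircase_in_M_of[OF assms(1)])
  qed
qed (use M_of_represents[OF assms] in blast)

section \<open>One-row letters and the tensor product rule\<close>

text \<open>The multiplicities become a periodic function \<open>x\<close>. The factor with exponent
  \<open>- x i\<close> sits at first index \<open>i - 1\<close>, so row \<open>i\<close> shows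
  \<open>- x (i + 1)\<close>.\<close>

definition letter_monomial :: "int \<Rightarrow> (int \<Rightarrow> int) \<Rightarrow> monomial \<Rightarrow> bool" where
  "letter_monomial n x a \<longleftrightarrow> a \<in> monomials n \<and> cyclic n x \<and> (\<forall>i. 0 \<le> x i) \<and>
     (\<forall>i\<in>idx n. \<forall>k. Poly_Mapping.lookup a (i, k) =
        (if k = 0 then x i else if k = 1 then - x (i + 1) else 0))"

text \<open>Here \<open>z\<close> is read only on \<open>{1..n}\<close>, where the representative of
  \<open>j\<close> is \<open>(j - 1) mod n + 1\<close>, that is \<open>n\<close> for
  \<open>j = 0\<close>.\<close>

lemma lookup_M1s_sum:
  fixes z :: "int \<Rightarrow> int"
  assumes "0 < n" "j \<in> idx n"
  shows "Poly_Mapping.lookup (\<Sum>i\<in>{1..n}. frag_cmul (- z i) (Yvar n (i - 1) 1)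
      + frag_cmul (z i) (Yvar n i 0)) (j, k) =
    (if k = 0 then z ((j - 1) mod n + 1) else if k = 1 then - z (j + 1) else 0)"
proof -
  have 1: "(i - 1) mod n = j \<longleftrightarrow> i = j + 1" if "i \<in> {1..n}" for i
    using that assms by (auto simp: idx_def)
  have 2: "i mod n = j \<longleftrightarrow> i = (j - 1) mod n + 1" if "i \<in> {1..n}" for i
  proof
    assume "i mod n = j"
    then have "(j - 1) mod n = (i - 1) mod n" by (metis mod_diff_left_eq)
    then show "i = (j - 1) mod n + 1" using that by simp
  next
    assume "i = (j - 1) mod n + 1"
    then show "i mod n = j" using assms(2) by (simp add: mod_add_left_eq)
  qed
  have mem: "(j - 1) mod n + 1 \<in> {1..n}" "j + 1 \<in> {1..n}"
    using assms pos_mod_bound[of n "j - 1"] pos_mod_sign[of n "j - 1"]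
    by (auto simp: idx_def simp del: pos_mod_bound pos_mod_sign)
  have "Poly_Mapping.lookup (\<Sum>i\<in>{1..n}. frag_cmul (- z i) (Yvar n (i - 1) 1)
      + frag_cmul (z i) (Yvar n i 0)) (j, k) =
    (\<Sum>i\<in>{1..n}. (if i = j + 1 then (if k = 1 then - z i else 0) else 0)
      + (if i = (j - 1) mod n + 1 then (if k = 0 then z i else 0) else 0))"
    unfolding lookup_sum
    by (rule sum.cong) (use 1 2 in \<open>auto simp: lookup_add lookup_Yvar\<close>)
  then show ?thesis using mem by (simp add: sum.distrib)
qed

lemma M1s_iff:
  assumes n: "0 < n"
  shows "a \<in> M1s n s \<longleftrightarrow> (\<exists>x. letter_monomial n x a \<and> sum x (idx n) = int s)"
proof
  assume "a \<in> M1s n s"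
  then obtain z :: "int \<Rightarrow> nat" where s: "(\<Sum>i\<in>{1..n}. z i) = s"
    and a: "a = (\<Sum>i\<in>{1..n}. frag_cmul (- int (z i)) (Yvar n (i - 1) 1)
      + frag_cmul (int (z i)) (Yvar n i 0))"
    by (auto simp: M1s_def)
  define x where "x i = int (z ((i - 1) mod n + 1))" for i
  have cyc: "cyclic n x" by (simp add: cyclic_def x_def mod_diff_left_eq)
  have "a \<in> monomials n"
    unfolding a using n by (intro monomials_sum monomials_add monomials_cmul monomials_Yvar)
  moreover have "x (j + 1) = int (z (j + 1))" if "j \<in> idx n" for j
    using that by (simp add: x_def)
  ultimately have "letter_monomial n x a"
    using cyc lookup_M1s_sum[OF n, of _ "\<lambda>i. int (z i)"]
    by (simp add: letter_monomial_def a) (simp add: x_def)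
  moreover have "sum x (idx n) = int s"
    using sum_cyclic_interval[OF n cyc] by (simp add: x_def s[symmetric])
  ultimately show "\<exists>x. letter_monomial n x a \<and> sum x (idx n) = int s" by blast
next
  assume "\<exists>x. letter_monomial n x a \<and> sum x (idx n) = int s"
  then obtain x where x: "letter_monomial n x a" and s: "sum x (idx n) = int s" by blast
  then have cyc: "cyclic n x" and pos: "0 \<le> x i" for i by (auto simp: letter_monomial_def)
  let ?b = "\<Sum>i\<in>{1..n}. frag_cmul (- x i) (Yvar n (i - 1) 1) + frag_cmul (x i) (Yvar n i 0)"
  have xr: "x ((i - 1) mod n + 1) = x i" for i
    by (rule cyclic_cong[OF cyc]) (simp add: mod_add_left_eq)
  have "a = ?b"
  proof (rule monomials_eqI[of _ n])
    show "?b \<in> monomials n"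
      using n by (intro monomials_sum monomials_add monomials_cmul monomials_Yvar)
  qed (use x lookup_M1s_sum[OF n, of _ x] xr in \<open>auto simp: letter_monomial_def\<close>)
  moreover have "int (\<Sum>i\<in>{1..n}. nat (x i)) = int s"
    using s sum_cyclic_interval[OF n cyc] pos by simp
  ultimately show "a \<in> M1s n s"
    unfolding M1s_def using pos by (intro CollectI exI[of _ "\<lambda>i. nat (x i)"]) (simp flip: of_nat_sum)
qed

lemma lower_sum_letter:
  assumes "letter_monomial n x a" "i \<in> idx n"
  shows "lower_sum a i k = (if k < 0 then 0 else if k = 0 then x i else x i - x (i + 1))"
  by (rule lower_sum_unique[of _ _ _ 0]) (use assms in \<open>auto simp: letter_monomial_def\<close>)

text \<open>The partial sums run through 0, \<open>x i\<close>, \<open>x i - x (i + 1)\<close>, so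
  the maximum sits at place 0; it is the first one if \<open>x i\<close> is nonzero and the last one
  if \<open>x (i + 1)\<close> is.\<close>

lemma letter_phi_eps:
  assumes "letter_monomial n x a" "i \<in> idx n"
  shows "mon_phi i a = x i" "mon_eps i a = x (i + 1)"
    "coroot_pairing i (mon_wt n a) = x i - x (i + 1)"
    "x i \<noteq> 0 \<Longrightarrow> mon_kf i a = 0" "x (i + 1) \<noteq> 0 \<Longrightarrow> mon_ke i a = 1"
proof -
  note L = lower_sum_letter[OF assms]
  have pos: "0 \<le> x j" for j using assms by (simp add: letter_monomial_def)
  show phi: "mon_phi i a = x i"
    by (rule phi_eqI[of _ _ _ 0]) (use pos in \<open>auto simp: L\<close>)
  have "row_total a i = x i - x (i + 1)"
    using lower_sum_eq_row_total[of 1 a i] assms by (simp add: L letter_monomial_def)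
  then show "coroot_pairing i (mon_wt n a) = x i - x (i + 1)" "mon_eps i a = x (i + 1)"
    using assms row_total_eq[of a n i] by (simp_all add: letter_monomial_def eps_eq phi)
  show "mon_kf i a = 0" if "x i \<noteq> 0"
    by (rule kf_eqI) (use pos[of i] that in \<open>auto simp: L phi\<close>)
  show "mon_ke i a = 1" if "x (i + 1) \<noteq> 0"
    using ke_eqI[of a i 0] pos[of "i + 1"] that by (simp add: L phi)
qed

text \<open>Moving \<open>d\<close> units from \<open>x i\<close> to \<open>x (i + 1)\<close> treats
  \<open>f\<close> (\<open>d = 1\<close>) and \<open>e\<close> (\<open>d = -1\<close>)
  together.\<close>

lemma letter_monomial_shift:
  assumes n: "3 \<le> n" and a: "letter_monomial n x a" and i: "i \<in> idx n"
    and pos: "\<And>j. (if j mod n = i then d else 0) \<le> x j + (if (j - 1) mod n = i then d else 0)"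
  shows "\<exists>x'. letter_monomial n x' (a - frag_cmul d (Avar n i 0)) \<and> sum x' (idx n) = sum x (idx n)"
proof -
  define x' where "x' j = x j - (if j mod n = i then d else 0) + (if (j - 1) mod n = i then d else 0)" for j
  define g where "g j = (if j mod n = i then d else 0)" for j
  have "cyclic n x'"
    using a by (simp add: letter_monomial_def cyclic_def x'_def mod_diff_left_eq)
  moreover have "0 \<le> x' j" for j using pos[of j] by (simp add: x'_def)
  moreover have "a - frag_cmul d (Avar n i 0) \<in> monomials n"
    using a n by (intro monomials_diff monomials_cmul monomials_Avar) (auto simp: letter_monomial_def)
  moreover have "Poly_Mapping.lookup (a - frag_cmul d (Avar n i 0)) (j, k) =
      (if k = 0 then x' j else if k = 1 then - x' (j + 1) else 0)" if j: "j \<in> idx n" for j k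
  proof -
    have [simp]: "(j - 1) mod n = i \<longleftrightarrow> (i + 1) mod n = j"
      and [simp]: "(i - 1) mod n = j \<longleftrightarrow> (j + 1) mod n = i"
      using i j pred_mod_eq_iff by blast+
    have "Poly_Mapping.lookup a (j, k) = (if k = 0 then x j else if k = 1 then - x (j + 1) else 0)"
      using a j by (simp add: letter_monomial_def)
    then show ?thesis
      using i j by (auto simp: lookup_minus lookup_add Avar_def lookup_Yvar x'_def)
  qed
  ultimately have "letter_monomial n x' (a - frag_cmul d (Avar n i 0))"
    by (simp add: letter_monomial_def)
  moreover have "sum x' (idx n) = sum x (idx n)"
  proof -
    have g: "cyclic n (\<lambda>j. g (j + - 1))" by (rule cyclic_comp_add) (simp add: cyclic_def g_def)
    have "sum x' (idx n) = sum x (idx n) - sum g (idx n) + (\<Sum>j\<in>idx n. g (j - 1))"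
      by (simp add: x'_def g_def sum.distrib sum_subtractf)
    then show ?thesis using sum_cyclic_shift[OF _ g] n by simp
  qed
  ultimately show ?thesis by blast
qed

lemma M1s_closed:
  assumes n: "3 \<le> n" and i: "i \<in> idx n" and a: "a \<in> M1s n s"
  shows "mon_e n i a = Some a' \<Longrightarrow> a' \<in> M1s n s"
    and "mon_f n i a = Some a' \<Longrightarrow> a' \<in> M1s n s"
proof -
  obtain x where x: "letter_monomial n x a" "sum x (idx n) = int s"
    using a n by (auto simp: M1s_iff)
  then have pos: "0 \<le> x j" and cyc: "cyclic n x" for j by (auto simp: letter_monomial_def)
  note le = letter_phi_eps[OF x(1) i]
  have iff: "a' \<in> M1s n s" if "\<exists>x'. letter_monomial n x' a' \<and> sum x' (idx n) = sum x (idx n)"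
    using that x n by (simp add: M1s_iff)
  show "a' \<in> M1s n s" if e: "mon_e n i a = Some a'"
  proof (rule iff)
    have nz: "x (i + 1) \<noteq> 0" and a': "a' = a - frag_cmul (-1) (Avar n i 0)"
      using e le by (auto simp: mon_e_def split: if_splits)
    have "x j = x (i + 1)" if "(j - 1) mod n = i" for j
      using that by (intro cyclic_cong[OF cyc])
        (metis add.commute diff_add_cancel mod_add_right_eq)
    then have "(if j mod n = i then - 1 else 0) \<le> x j + (if (j - 1) mod n = i then - 1 else 0)" for j
      using nz pos[of j] pos[of "i + 1"] by auto
    then show "\<exists>x'. letter_monomial n x' a' \<and> sum x' (idx n) = sum x (idx n)"
      unfolding a' by (rule letter_monomial_shift[OF n x(1) i])
  qed
  show "a' \<in> M1s n s" if f: "mon_f n i a = Some a'"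
  proof (rule iff)
    have nz: "x i \<noteq> 0" and a': "a' = a - frag_cmul 1 (Avar n i 0)"
      using f le by (auto simp: mon_f_def split: if_splits)
    have "x j = x i" if "j mod n = i" for j
      using that i by (intro cyclic_cong[OF cyc]) simp
    then have "(if j mod n = i then 1 else 0) \<le> x j + (if (j - 1) mod n = i then 1 else 0)" for j
      using nz pos[of j] pos[of i] by auto
    then show "\<exists>x'. letter_monomial n x' a' \<and> sum x' (idx n) = sum x (idx n)"
      unfolding a' by (rule letter_monomial_shift[OF n x(1) i])
  qed
qed

section \<open>The shift and the tensor product rule for \<open>a + tau 1 b\<close>\<close>

lemma lookup_tau: "Poly_Mapping.lookup (tau j m) (i, k) = Poly_Mapping.lookup m (i, k - j)"
proof -
  have "Poly_Mapping.lookup (tau j m) (i, k) =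
      (\<Sum>p\<in>Poly_Mapping.keys m. if p = (i, k - j) then Poly_Mapping.lookup m p else 0)"
    unfolding tau_def frag_extend_def lookup_sum
    by (rule sum.cong) (auto simp: lookup_single when_def split: prod.splits)
  then show ?thesis by (simp add: in_keys_iff)
qed

lemma tau_add: "tau j (m + m') = tau j m + tau j m'"
  and tau_diff: "tau j (m - m') = tau j m - tau j m'"
  by (simp_all add: tau_def frag_extend_add frag_extend_diff)

lemma tau_Avar: "tau j (Avar n i k) = Avar n i (k + j)"
  by (simp add: tau_def Avar_def Yvar_def frag_extend_add frag_extend_diff algebra_simps)

lemma monomials_tau: "m \<in> monomials n \<Longrightarrow> tau j m \<in> monomials n"
  by (auto simp: monomials_def in_keys_iff lookup_tau subset_iff)

lemma mon_wt_tau: "mon_wt n (tau j m) = mon_wt n m"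
  unfolding tau_def mon_wt_def
  by (induction m rule: frag_induction[OF subset_UNIV])
    (auto simp: frag_extend_diff)

lemma lower_sum_tau: "lower_sum (tau j m) i k = lower_sum m i (k - j)"
proof -
  obtain a b where a: "\<And>k. k < a \<Longrightarrow> lower_sum m i k = 0"
    using lower_sum_bounds[of m i] by metis
  show ?thesis
  proof (rule lower_sum_unique)
    show "lower_sum m i (k - j) = lower_sum m i (k - 1 - j) + Poly_Mapping.lookup (tau j m) (i, k)" for k
      using lower_sum_step[of m i "k - j"] by (simp add: lookup_tau algebra_simps)
    show "lower_sum m i (k - j) = 0" if "k < a + j" for k
      using that by (intro a) simp
  qed
qed

context
  fixes n :: int and x :: "int \<Rightarrow> int" and a b :: monomial and i :: int
  assumes n: "3 \<le> n" and a: "letter_monomial n x a" and b: "b \<in> monomials n"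
    and supp: "\<And>i k. i \<in> idx n \<Longrightarrow> k < 0 \<Longrightarrow> Poly_Mapping.lookup b (i, k) = 0"
    and start: "\<And>i. i \<in> idx n \<Longrightarrow> 0 \<le> Poly_Mapping.lookup b (i, 0)"
    and i: "i \<in> idx n"
begin

private lemma x_pos: "0 \<le> x j"
  using a by (simp add: letter_monomial_def)

private lemma lower_sum_b: "k < 0 \<Longrightarrow> lower_sum b i k = 0"
  by (rule lower_sum_eq_0) (use supp i in simp)

text \<open>The shifted \<open>b\<close> starts in column 1, so column 0 sees only \<open>a\<close>,
  and from column 1 on \<open>a\<close> contributes its full row total.\<close>

private lemma lower_sum_product:
  "lower_sum (a + tau 1 b) i k =
    (if k < 0 then 0 else if k = 0 then x i else x i - x (i + 1) + lower_sum b i (k - 1))"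
  by (simp add: lower_sum_add lower_sum_tau lower_sum_letter[OF a i] lower_sum_b)

private lemma product_in: "a + tau 1 b \<in> monomials n"
  using a b by (auto simp: letter_monomial_def intro: monomials_tau)

private lemma phi_b_attained: "mon_phi i b = 0 \<or> (\<exists>k\<ge>0. lower_sum b i k = mon_phi i b)"
  using phi_attained[of b i] lower_sum_b by (metis not_le)

text \<open>Places before 0 of \<open>b\<close> have no counterpart in the product beyond column 0.
  They could matter only if \<open>mon_phi i b\<close> is 0, and then \<open>x i\<close> dominates
  because \<open>x (i + 1)\<close> is nonnegative.\<close>

lemma phi_product: "mon_phi i (a + tau 1 b) = max (x i) (mon_phi i b + x i - x (i + 1))"
proof (cases "x (i + 1) < mon_phi i b")
  case True
  then obtain k where k: "0 \<le> k" "lower_sum b i k = mon_phi i b"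
    using phi_b_attained x_pos[of "i + 1"] by force
  show ?thesis
  proof (rule phi_eqI)
    show "lower_sum (a + tau 1 b) i t \<le> max (x i) (mon_phi i b + x i - x (i + 1))" for t
      using lower_sum_le_phi[of b i "t - 1"] x_pos[of i] by (auto simp: lower_sum_product)
    show "lower_sum (a + tau 1 b) i (k + 1) = max (x i) (mon_phi i b + x i - x (i + 1))"
      using k True by (simp add: lower_sum_product)
  qed
next
  case False
  show ?thesis
  proof (rule phi_eqI)
    show "lower_sum (a + tau 1 b) i t \<le> max (x i) (mon_phi i b + x i - x (i + 1))" for t
      using lower_sum_le_phi[of b i "t - 1"] x_pos[of i] by (auto simp: lower_sum_product)
    show "lower_sum (a + tau 1 b) i 0 = max (x i) (mon_phi i b + x i - x (i + 1))"
      using False by (simp add: lower_sum_product)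
  qed
qed

lemma eps_product: "mon_eps i (a + tau 1 b) = max (mon_eps i b) (x (i + 1) - coroot_pairing i (mon_wt n b))"
proof -
  have "coroot_pairing i (mon_wt n (a + tau 1 b)) =
      x i - x (i + 1) + coroot_pairing i (mon_wt n b)"
    using letter_phi_eps(3)[OF a i] mon_wt_tau[of n 1 b]
    by (simp add: mon_wt_def frag_extend_add coroot_pairing_add)
  then show ?thesis
    using eps_eq_phi_wt[OF product_in i] eps_eq_phi_wt[OF b i] by (simp add: phi_product)
qed

text \<open>\<open>mon_e\<close> acts at the last maximum. This is column 0, hence in
  \<open>a\<close>, exactly when \<open>x (i + 1)\<close> strictly exceeds
  \<open>mon_phi i b\<close>; a tie goes to \<open>b\<close>.\<close>

lemma e_product:
  "mon_e n i (a + tau 1 b) =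
    (if x (i + 1) > mon_phi i b then map_option (\<lambda>a'. a' + tau 1 b) (mon_e n i a)
     else map_option (\<lambda>b'. a + tau 1 b') (mon_e n i b))"
proof (cases "x (i + 1) > mon_phi i b")
  case True
  have nz: "x (i + 1) \<noteq> 0" using True phi_ge_0[of i b] by simp
  have "mon_ke i (a + tau 1 b) = 0 + 1"
  proof (rule ke_eqI)
    show "lower_sum (a + tau 1 b) i k < mon_phi i (a + tau 1 b)" if "k > 0" for k
      using that True lower_sum_le_phi[of b i "k - 1"] by (simp add: lower_sum_product phi_product)
  qed (use True in \<open>simp add: lower_sum_product phi_product\<close>)
  moreover have "mon_eps i (a + tau 1 b) \<noteq> 0"
    using True total_le_phi[of b i] row_total_eq[OF b i] by (simp add: eps_product)
  ultimately show ?thesis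
    using True nz letter_phi_eps[OF a i] by (simp add: mon_e_def algebra_simps)
next
  case False
  then have eps: "mon_eps i (a + tau 1 b) = mon_eps i b"
    using eps_eq_phi_wt[OF b i] by (simp add: eps_product)
  show ?thesis
  proof (cases "mon_eps i b = 0")
    case True
    then show ?thesis using False eps by (simp add: mon_e_def)
  next
    case nz: False
    note K = ke_props[OF nz]
    \<comment> \<open>A last maximum of \<open>b\<close> before place 0 would have value 0, and the
      next sums would be negative, against \<open>start\<close>.\<close>
    have K0: "0 \<le> mon_ke i b - 1"
    proof (rule ccontr)
      assume neg: "\<not> 0 \<le> mon_ke i b - 1"
      then have "mon_phi i b = 0" using K(1) lower_sum_b by simp
      moreover have "0 \<le> lower_sum b i 0"
        using start[OF i] lower_sum_step[of b i 0] lower_sum_b[of "-1"] by simp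
      ultimately show False using K(2)[of 0] neg by simp
    qed
    have "mon_ke i (a + tau 1 b) = mon_ke i b + 1"
    proof (rule ke_eqI)
      show "lower_sum (a + tau 1 b) i (mon_ke i b) = mon_phi i (a + tau 1 b)"
        using K0 K(1) False by (simp add: lower_sum_product phi_product)
      show "lower_sum (a + tau 1 b) i k < mon_phi i (a + tau 1 b)" if "k > mon_ke i b" for k
        using that K0 K(2)[of "k - 1"] False by (simp add: lower_sum_product phi_product)
    qed
    then show ?thesis
      using False eps nz by (simp add: mon_e_def tau_add tau_Avar algebra_simps)
  qed
qed

text \<open>\<open>mon_f\<close> acts at the first maximum, so a tie now goes to column 0, hence to
  \<open>a\<close>.\<close>

lemma f_product:
  "mon_f n i (a + tau 1 b) =
    (if x (i + 1) \<ge> mon_phi i b then map_option (\<lambda>a'. a' + tau 1 b) (mon_f n i a)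
     else map_option (\<lambda>b'. a + tau 1 b') (mon_f n i b))"
proof (cases "x (i + 1) \<ge> mon_phi i b")
  case True
  then have phi: "mon_phi i (a + tau 1 b) = x i"
    by (simp add: phi_product)
  show ?thesis
  proof (cases "x i = 0")
    case nz: False
    have "mon_kf i (a + tau 1 b) = 0"
      by (rule kf_eqI) (use nz x_pos[of i] in \<open>simp_all add: lower_sum_product phi\<close>)
    then show ?thesis
      using True nz phi letter_phi_eps[OF a i] by (simp add: mon_f_def algebra_simps)
  qed (use True phi letter_phi_eps[OF a i] in \<open>simp add: mon_f_def\<close>)
next
  case False
  then have phi: "mon_phi i (a + tau 1 b) = mon_phi i b + x i - x (i + 1)"
    by (simp add: phi_product)
  have nz: "mon_phi i b \<noteq> 0" using False x_pos[of "i + 1"] by simp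
  note K = kf_props[OF nz]
  have K0: "0 \<le> mon_kf i b" using K(1) lower_sum_b nz by (metis not_le)
  have "mon_kf i (a + tau 1 b) = mon_kf i b + 1"
  proof (rule kf_eqI)
    show "lower_sum (a + tau 1 b) i (mon_kf i b + 1) = mon_phi i (a + tau 1 b)"
      using K0 K(1) by (simp add: lower_sum_product phi)
    show "lower_sum (a + tau 1 b) i k < mon_phi i (a + tau 1 b)" if "k < mon_kf i b + 1" for k
      using that K(2)[of "k - 1"] False x_pos[of i] by (auto simp: lower_sum_product phi)
  qed
  moreover have "mon_phi i (a + tau 1 b) \<noteq> 0" using False phi x_pos[of i] by simp
  ultimately show ?thesis
    using False nz by (simp add: mon_f_def tau_diff tau_Avar algebra_simps)
qed

end

section \<open>Products as patterns, and the isomorphism\<close>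

text \<open>The cyclic difference equation for \<open>d\<close> is solved by partial sums of
  \<open>l - x\<close>; equal totals make the solution close up between residues
  \<open>n - 1\<close> and 0.\<close>

lemma letter_as_column:
  fixes l x :: "int \<Rightarrow> int"
  assumes n: "0 < n" and "cyclic n l" "cyclic n x" and eq: "sum x (idx n) = sum l (idx n)"
  obtains d where "cyclic n d" "\<And>i. x i = l i - d i + d (i - 1)"
proof -
  define h where "h = (\<lambda>j. l j - x j)"
  have h: "cyclic n h" using assms by (simp add: cyclic_def h_def)
  have h0: "sum h {0..<n} = 0"
    using eq by (simp add: h_def sum_subtractf idx_def)
  define d where "d i = sum h {0..i mod n}" for i
  have "d i - d (i - 1) = h i" for i
  proof (cases "i mod n = 0")
    case True
    have "(i - 1) mod n = (i mod n - 1) mod n" by (simp add: mod_diff_left_eq)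
    also have "\<dots> = n - 1" using True n by (simp add: zmod_minus1)
    finally have "d (i - 1) = sum h {0..<n}"
      by (simp add: d_def) (rule sum.cong, auto)
    moreover have "d i = h i" using True cyclic_cong[OF h, of 0 i] by (simp add: d_def)
    ultimately show ?thesis using h0 by simp
  next
    case False
    have lt: "0 < i mod n" "i mod n < n" using False n pos_mod_sign[of n i] pos_mod_bound[of n i] by linarith+
    have "(i - 1) mod n = (i mod n - 1) mod n" by (simp add: mod_diff_left_eq)
    also have "\<dots> = i mod n - 1" using lt by (intro mod_pos_pos_trivial) auto
    finally have "d (i - 1) = sum h {0..i mod n - 1}" by (simp add: d_def)
    moreover have "{0..i mod n} = insert (i mod n) {0..i mod n - 1}" using lt by auto
    moreover have "h (i mod n) = h i" using h by (simp add: cyclic_def)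
    ultimately show ?thesis by (simp add: d_def)
  qed
  then have "x i = l i - d i + d (i - 1)" for i
    by (simp add: h_def algebra_simps)
  moreover have "cyclic n d" by (simp add: cyclic_def d_def)
  ultimately show thesis using that by blast
qed

text \<open>The new pattern has the solution \<open>d\<close> as row 0 and the rows of
  \<open>c\<close> moved one place on. Passing from \<open>l\<close> to its shift by one compensates
  for this move.\<close>

lemma represents_product:
  assumes n: "0 < n" and a: "letter_monomial n x a" and sum: "sum x (idx n) = sum l (idx n)"
    and l: "cyclic n l" and p: "pattern n (\<lambda>i. l (i + 1)) N c"
    and r: "represents n (\<lambda>i. l (i + 1)) c b"
  obtains N' c' where "pattern n l N' c'" "represents n l c' (a + tau 1 b)"
proof -
  have xc: "cyclic n x" and x0: "0 \<le> x i" for i using a by (auto simp: letter_monomial_def)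
  obtain d where d: "cyclic n d" and xd: "\<And>i. x i = l i - d i + d (i - 1)"
    using letter_as_column[OF n l xc sum] by metis
  define c' where "c' k = (if k = 0 then d else if k < 0 then (\<lambda>_. 0) else c (k - 1))" for k
  have z: "c k i = 0" if "k < 0" for k i using p that by (auto simp: pattern_def)
  have lt: "letter l c' k i = (if k = 0 then x i else letter (\<lambda>i. l (i + 1)) c (k - 1) i)"
    if "0 \<le> k" for k i
    using that xd[of i] by (auto simp: letter_def c'_def algebra_simps)
  \<comment> \<open>\<open>N\<close> may be 0 or negative, but row 0 always has to be
    covered.\<close>
  have "pattern n l (max 1 (N + 1)) c'"
    using p l d x0 by (auto simp: pattern_def lt) (auto simp: c'_def cyclic_def)
  moreover have "represents n l c' (a + tau 1 b)"
    unfolding represents_def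
  proof (intro conjI ballI allI)
    show "a + tau 1 b \<in> monomials n"
      using a r by (auto simp: letter_monomial_def represents_def intro: monomials_tau)
    fix i k
    assume i: "i \<in> idx n"
    have "Poly_Mapping.lookup (a + tau 1 b) (i, k) =
       (if k = 0 then x i else if k = 1 then - x (i + 1) else 0) +
       ((if k - 1 = 0 then l (i + 1) else 0) - c (k - 1) i + c (k - 1) (i - 1) - c (k - 1 - 1) i
         + c (k - 1 - 1) (i + 1))"
      using a r i by (simp add: lookup_add lookup_tau letter_monomial_def represents_def)
    also have "\<dots> = (if k = 0 then l i else 0) - c' k i + c' k (i - 1) - c' (k - 1) i
        + c' (k - 1) (i + 1)"
      using xd[of i] xd[of "i + 1"] z by (auto simp: c'_def)
    finally show "Poly_Mapping.lookup (a + tau 1 b) (i, k) =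
      (if k = 0 then l i else 0) - c' k i + c' k (i - 1) - c' (k - 1) i + c' (k - 1) (i + 1)" .
  qed
  ultimately show thesis using that by blast
qed

lemma is_crystal_M_of:
  assumes "3 \<le> n" "dominant n w"
  shows "is_crystal n (monomial_crystal n (M_of n w))"
proof (rule is_crystal_monomial_crystal[OF assms(1)])
  show "M_of n w \<subseteq> monomials n"
    using M_of_represents[OF assms] by (auto simp: represents_def)
qed (auto intro: M_of.step_e M_of.step_f)

lemma is_crystal_M1s:
  assumes "3 \<le> n"
  shows "is_crystal n (monomial_crystal n (M1s n s))"
proof (rule is_crystal_monomial_crystal[OF assms])
  show "M1s n s \<subseteq> monomials n"
    using assms by (auto simp: M1s_iff letter_monomial_def)
qed (use M1s_closed[OF assms] in blast)+

theorem theorem4p5: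
  fixes n :: int and s :: nat and lam mu :: weight
  assumes "n \<ge> 3" and "s \<ge> 1"
    and "dominant n lam" and "level n lam = int s"
    and "mu = (\<Sum>i\<in>idx n. frag_cmul (coroot_pairing i lam) (fund_weight n (i - 1)))"
  shows "crystal_iso n
           (tensor (monomial_crystal n (M1s n s)) (monomial_crystal n (M_of n mu)))
           (monomial_crystal n (M_of n lam))
           (\<lambda>(m, m'). m + tau 1 m')"
proof -
  let ?l = "weight_coeff n lam" and ?\<Phi> = "\<lambda>(m, m'). m + tau 1 m'"
  let ?T = "tensor (monomial_crystal n (M1s n s)) (monomial_crystal n (M_of n mu))"
  have n: "0 < n" using assms(1) by simp
  have l: "cyclic n ?l" by (rule cyclic_weight_coeff)
  have l0: "0 \<le> ?l i" for i
    using assms(3) n by (simp add: dominant_def weight_coeff_def)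
  have suml: "sum ?l (idx n) = int s"
    using assms(4) by (simp add: level_def weight_coeff_def)
  have mu_coeff: "Poly_Mapping.lookup mu j = ?l (j + 1)" if "j \<in> idx n" for j
  proof -
    have "Poly_Mapping.lookup mu j =
        (\<Sum>i\<in>idx n. if i = (j + 1) mod n then coroot_pairing i lam else 0)"
      unfolding assms(5) lookup_sum
    proof (rule sum.cong[OF refl])
      fix i assume "i \<in> idx n"
      then have eq: "(i - 1) mod n = j \<longleftrightarrow> i = (j + 1) mod n"
        using pred_mod_eq_iff[of i n j] that by auto
      then show "Poly_Mapping.lookup (frag_cmul (coroot_pairing i lam) (fund_weight n (i - 1))) j =
          (if i = (j + 1) mod n then coroot_pairing i lam else 0)"
        unfolding fund_weight_def eq[symmetric] by (simp add: lookup_single when_def)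
    qed
    then show ?thesis using n by (simp add: weight_coeff_def)
  qed
  \<comment> \<open>This is the shifted ground state for which \<open>represents_product\<close> is
    stated.\<close>
  have mu: "weight_coeff n mu = (\<lambda>i. ?l (i + 1))"
  proof
    fix i
    show "weight_coeff n mu i = ?l (i + 1)"
      using mu_coeff[of "i mod n"] n cyclic_cong[OF l, of "i mod n + 1" "i + 1"]
      by (simp add: weight_coeff_def coroot_pairing_def mod_add_left_eq)
  qed
  have mu_dom: "dominant n mu"
    unfolding dominant_def
  proof
    show "mu \<in> weight_lattice n"
      unfolding weight_lattice_def mem_Collect_eq assms(5)
      by (rule order_trans[OF keys_sum]) (use n in \<open>auto simp: fund_weight_def split: if_splits\<close>)
    show "\<forall>i\<in>idx n. 0 \<le> coroot_pairing i mu"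
      using mu_coeff l0 by (simp add: coroot_pairing_def)
  qed
  \<comment> \<open>These are the conditions on the second factor under which the tensor product
    rule was proved; the start is nonnegative because it is a letter of row 0.\<close>
  have B: "b \<in> monomials n \<and> (\<forall>i\<in>idx n. \<forall>k<0. Poly_Mapping.lookup b (i, k) = 0) \<and>
      (\<forall>i\<in>idx n. 0 \<le> Poly_Mapping.lookup b (i, 0))" if b: "b \<in> M_of n mu" for b
  proof -
    obtain N c where p: "pattern n (weight_coeff n mu) N c"
      and r: "represents n (weight_coeff n mu) c b"
      using M_of_represents[OF assms(1) mu_dom b] by blast
    from p have "0 \<le> letter (weight_coeff n mu) c 0 i" for i by (simp add: pattern_def)
    moreover have "b \<in> monomials n" using r by (simp add: represents_def)
    ultimately show ?thesis
      using lookup_represents[OF p r] by simp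
  qed
  have crystals: "is_crystal n ?T" "is_crystal n (monomial_crystal n (M_of n lam))"
    using assms(1,3) mu_dom by (auto intro!: is_crystal_tensor is_crystal_M1s is_crystal_M_of)
  have commute: "mon_eps i (?\<Phi> p) = cry_eps ?T i p \<and> mon_phi i (?\<Phi> p) = cry_phi ?T i p \<and>
      mon_e n i (?\<Phi> p) = map_option ?\<Phi> (cry_e ?T i p) \<and>
      mon_f n i (?\<Phi> p) = map_option ?\<Phi> (cry_f ?T i p)"
    if p: "p \<in> elems ?T" and i: "i \<in> idx n" for i p
  proof -
    obtain a b where ab: "p = (a, b)" by force
    then have a: "a \<in> M1s n s" and b: "b \<in> M_of n mu"
      using p by (auto simp: tensor_def monomial_crystal_def)
    obtain x where x: "letter_monomial n x a"
      using a n by (auto simp: M1s_iff)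
    note prod = phi_product eps_product e_product f_product
    note prod' = prod[OF assms(1) x conjunct1[OF B[OF b]], of i]
    have "\<And>i k. i \<in> idx n \<Longrightarrow> k < 0 \<Longrightarrow> Poly_Mapping.lookup b (i, k) = 0"
      "\<And>i. i \<in> idx n \<Longrightarrow> 0 \<le> Poly_Mapping.lookup b (i, 0)" using B[OF b] by auto
    note prod'' = prod'[OF this i]
    show ?thesis
      using prod'' letter_phi_eps[OF x i]
      by (simp add: ab tensor_def monomial_crystal_def option.map_comp comp_def)
  qed
  have wt: "mon_wt n (?\<Phi> p) = cry_wt ?T p" for p
    using mon_wt_tau[of n 1 "snd p"]
    by (simp add: tensor_def monomial_crystal_def case_prod_unfold mon_wt_def frag_extend_add)
  \<comment> \<open>Column 0 of the product comes from \<open>a\<close> alone and determines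
    \<open>x\<close>, hence \<open>a\<close>; the shifted second factor then cancels.\<close>
  have inj: "inj_on ?\<Phi> (elems ?T)"
  proof (rule inj_onI)
    fix p q
    assume p: "p \<in> elems ?T" and q: "q \<in> elems ?T" and eq: "?\<Phi> p = ?\<Phi> q"
    obtain a b a' b' where pq: "p = (a, b)" "q = (a', b')" by (metis surj_pair)
    then have "a \<in> M1s n s" "a' \<in> M1s n s" and b: "b \<in> M_of n mu" "b' \<in> M_of n mu"
      using p q by (auto simp: tensor_def monomial_crystal_def)
    then obtain x x' where x: "letter_monomial n x a" "letter_monomial n x' a'"
      using n by (auto simp: M1s_iff)
    have eq': "a + tau 1 b = a' + tau 1 b'" using eq pq by simp
    have "x i = x' i" if "i \<in> idx n" for i
    proof -
      have "Poly_Mapping.lookup (a + tau 1 b) (i, 0) = Poly_Mapping.lookup (a' + tau 1 b') (i, 0)"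
        using eq' by simp
      then show ?thesis
        using that x B[OF b(1)] B[OF b(2)]
        by (simp add: lookup_add lookup_tau letter_monomial_def)
    qed
    then have "x (i mod n) = x' (i mod n)" for i using n by simp
    then have "x = x'" using x by (auto simp: letter_monomial_def cyclic_def)
    then have aa: "a = a'"
      using x by (intro monomials_eqI[of _ n]) (auto simp: letter_monomial_def)
    have "b = b'"
    proof (rule monomials_eqI[of _ n])
      fix i k
      have "Poly_Mapping.lookup (tau 1 b) (i, k + 1) = Poly_Mapping.lookup (tau 1 b') (i, k + 1)"
        using eq' aa by simp
      then show "Poly_Mapping.lookup b (i, k) = Poly_Mapping.lookup b' (i, k)"
        by (simp add: lookup_tau)
    qed (use B b in auto)
    then show "p = q" using pq aa by simp
  qed
  have into: "?\<Phi> p \<in> M_of n lam" if p: "p \<in> elems ?T" for p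
  proof -
    obtain a b where ab: "p = (a, b)" by force
    then have a: "a \<in> M1s n s" and b: "b \<in> M_of n mu"
      using p by (auto simp: tensor_def monomial_crystal_def)
    obtain x where x: "letter_monomial n x a" "sum x (idx n) = sum ?l (idx n)"
      using a n suml by (auto simp: M1s_iff)
    obtain N c where c: "pattern n (\<lambda>i. ?l (i + 1)) N c" "represents n (\<lambda>i. ?l (i + 1)) c b"
      using M_of_represents[OF assms(1) mu_dom b] by (auto simp: mu)
    obtain N' c' where "pattern n ?l N' c'" "represents n ?l c' (a + tau 1 b)"
      using represents_product[OF n x l c] .
    then show ?thesis
      using M_of_iff[OF assms(1,3)] ab by auto
  qed
  \<comment> \<open>No monomial is factored explicitly: the image contains the generator and is
    closed under all operators, since they commute with the map and preserve the tensor
    product.\<close>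
  have onto: "m \<in> ?\<Phi> ` elems ?T" if "m \<in> M_of n lam" for m
    using that
  proof induction
    case base
    \<comment> \<open>The ground state letter: its negative part in column 1 cancels the shifted
      \<open>Y_weight n mu\<close>.\<close>
    define a where "a = Y_weight n lam - tau 1 (Y_weight n mu)"
    have ylam: "represents n ?l (\<lambda>_ _. 0) (Y_weight n lam)"
      and ymu: "represents n (weight_coeff n mu) (\<lambda>_ _. 0) (Y_weight n mu)"
      using n by (rule represents_Y_weight)+
    have "a \<in> monomials n"
      using ylam ymu by (auto simp: a_def represents_def intro: monomials_tau)
    then have "letter_monomial n ?l a"
      using ylam ymu l l0
      by (auto simp: letter_monomial_def a_def lookup_minus lookup_tau represents_def mu)
    then have "a \<in> M1s n s" using n suml by (auto simp: M1s_iff)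
    then have "(a, Y_weight n mu) \<in> elems ?T"
      by (simp add: tensor_def monomial_crystal_def M_of.base)
    then show ?case by (rule rev_image_eqI) (simp add: a_def)
  next
    case (step_e m i m')
    then obtain p where p: "p \<in> elems ?T" "m = ?\<Phi> p" by blast
    then obtain q where q: "cry_e ?T i p = Some q" "m' = ?\<Phi> q"
      using commute[OF p(1) step_e(2)] step_e(3) by auto
    then show ?case using is_crystal_eD[OF crystals(1) step_e(2) p(1) q(1)] by blast
  next
    case (step_f m i m')
    then obtain p where p: "p \<in> elems ?T" "m = ?\<Phi> p" by blast
    then obtain q where q: "cry_f ?T i p = Some q" "m' = ?\<Phi> q"
      using commute[OF p(1) step_f(2)] step_f(3) by auto
    then show ?case using is_crystal_fD[OF crystals(1) step_f(2) p(1) q(1)] by blast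
  qed
  have "bij_betw ?\<Phi> (elems ?T) (M_of n lam)"
    unfolding bij_betw_def using inj into onto by blast
  then show ?thesis
    unfolding crystal_iso_def using crystals commute wt
    by (simp add: monomial_crystal_def)
qed

end
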